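(* Let $\widetilde C$ and $\widetilde R$ be the convex hull of $C$ and the concave hull of $R$, and let $$\widetilde u\in\arg\max\{\widetilde R(u)-\widetilde C(u):u\in\mathrm{co}\,Q\cap\mathrm{co}\,A\}.$$ (i) The static strategy $\alpha_t=q_t=\widetilde u$, $t\ge 0$, is optimal for the convexified problem with zero initial inventory, i.e. it attains the supremum defining $\widetilde v(0)$. (ii) There exist $q^i\in Q$, $\alpha^i\in A$, $i=1,2$, and $\gamma\in(0,1)$, $\nu\in(0,1)$ such that $$\widetilde u=\gamma q^1+(1-\gamma)q^2=\nu\alpha^1+(1-\nu)\alpha^2,$$ $$\widetilde R(\widetilde u)=\gamma R(q^1)+(1-\gamma)R(q^2),\quad \widetilde C(\widetilde u)=\nu C(\alpha^1)+(1-\nu)C(\alpha^2).$$ The relaxed static strategy $$\overline q_t(dx)=\gamma\delta_{q^1}(dx)+(1-\gamma)\delta_{q^2}(dx),\quad \overline\alpha_t(dx)=\nu\delta_{\alpha^1}(dx)+(1-\nu)\delta_{\alpha^2}(dx),\quad t\ge0,$$ is a solution of the relaxed problem with zero initial inventory, i.e. it attains the supremum defining $v_r(0)$. Here $\delta_a$ is the Dirac measure concentrated at $a$.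
   Context: Setting. $\mathbb R_+=[0,\infty)$. $A\subset\mathbb R_+$ is a closed set and $Q\subset\mathbb R_+$ is a compact set, with $0\in A\cap Q$, $A\setminus\{0\}\ne\emptyset$, $Q\setminus\{0\}\neq\emptyset$. The revenue $R:Q\to\mathbb R_+$ is continuous with $R(0)=0$. The production cost $C:A\to\mathbb R_+$ is continuous and non-decreasing; if $A$ is unbounded, then additionally $C(\alpha)/\alpha\to+\infty$ as $A\ni\alpha\to+\infty$. The constant $\beta>0$ is fixed. Convexified problem. For $G\subset\mathbb R$, $\mathrm{co}\,G$ is the intersection of all intervals containing $G$. Put $C=+\infty$ off $A$ and $R=-\infty$ off $Q$. For $f:\mathbb R\to(-\infty,+\infty]$ with $\mathrm{dom} f=\{f<\infty\}$, $$(\mathrm{co} f)(x)=\inf\{\delta f(x_1)+(1-\delta)f(x_2):\delta\in[0,1],\ x_i\in\mathrm{dom} f,\ \delta x_1+(1-\delta)x_2=x\}.$$ Let $\widetilde C=\mathrm{co}\,C$ and $\widetilde R=-\mathrm{co}(-R)$ (finite exactly on $\mathrm{co}\,A$ and $\mathrm{co}\,Q$ respectively). For $x\ge0$ let $\widetilde{\mathscr A}(x)$ be the set of pairs of Borel measurable functions $\alpha:\mathbb R_+\to\mathrm{co}\,A$, $q:\mathbb R_+\to\mathrm{co}\,Q$ ($\alpha$ locally integrable) with $x+\int_0^t(\alpha_s-q_s)\,ds\ge0$ for all $t\ge0$, and $$\widetilde v(x)=\sup_{(\alpha,q)\in\widetilde{\mathscr A}(x)}\int_0^\infty e^{-\beta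 t}(\widetilde R(q_t)-\widetilde C(\alpha_t))\,dt.$$ Relaxed problem. Relaxed controls $q_t(dy)$, $\alpha_t(dy)$ are mappings from $[0,\infty)$ to the sets of probability measures on $Q$ and $A$ respectively such that $t\mapsto\int_Q\varphi(y)\,q_t(dy)$ and $t\mapsto\int_A\varphi(y)\,\alpha_t(dy)$ are Borel measurable for every bounded continuous function $\varphi$. The class $\mathscr A_r(x)$ consists of those relaxed controls (with $t\mapsto\int_A y\,\alpha_t(dy)$ locally integrable) for which $$X_t=x+\int_0^t\int_A y\,\alpha_s(dy)\,ds-\int_0^t\int_Q y\,q_s(dy)\,ds\ge0\quad\text{for all }t\ge0,$$ and $$v_r(x)=\sup_{(\alpha,q)\in\mathscr A_r(x)}\left(\int_0^\infty e^{-\beta t}\int_Q R(y)\,q_t(dy)\,dt-\int_0^\infty e^{-\beta t}\int_A C(y)\,\alpha_t(dy)\,dt\right).$$ *)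

theory Defs
  imports "HOL-Probability.Probability"
begin

definition eff_dom :: "(real \<Rightarrow> ereal) \<Rightarrow> real set" where
  "eff_dom f = {x. f x < \<infinity>}"

text \<open>
  The hull is an infimum in the extended reals, so it is \<open>\<infinity>\<close> wherever there is no
  admissible representation of the argument.
\<close>

definition convex_fun_hull :: "(real \<Rightarrow> ereal) \<Rightarrow> real \<Rightarrow> ereal" where
  "convex_fun_hull f x =
     Inf {ereal \<delta> * f x1 + ereal (1 - \<delta>) * f x2 | \<delta> x1 x2.
            0 \<le> \<delta> \<and> \<delta> \<le> 1 \<and> x1 \<in> eff_dom f \<and> x2 \<in> eff_dom f \<and> \<delta> * x1 + (1 - \<delta>) * x2 = x}"

text \<open>
  The data \<open>C\<close> on \<open>A\<close> and \<open>R\<close> on \<open>Q\<close> are total real functions of which only the values on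
  \<open>A\<close> and \<open>Q\<close> are used; they are extended by \<open>\<infinity>\<close> and \<open>-\<infinity>\<close>, respectively.
\<close>

definition conv_cost :: "real set \<Rightarrow> (real \<Rightarrow> real) \<Rightarrow> real \<Rightarrow> ereal" where
  "conv_cost A C = convex_fun_hull (\<lambda>a. if a \<in> A then ereal (C a) else \<infinity>)"

definition conc_revenue :: "real set \<Rightarrow> (real \<Rightarrow> real) \<Rightarrow> real \<Rightarrow> ereal" where
  "conc_revenue Q R = (\<lambda>y. - convex_fun_hull (\<lambda>z. - (if z \<in> Q then ereal (R z) else -\<infinity>)) y)"

text \<open>
  Lebesgue integral with values in the extended reals, as the difference of the integrals of
  the positive and the negative part (\<open>e2ennreal\<close> maps negative values to 0). It is only used
  for integrands whose positive part has a finite integral; the integral of the negative part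
  may be infinite, in which case the value is \<open>-\<infinity>\<close>.
\<close>

definition ereal_integral :: "'a measure \<Rightarrow> ('a \<Rightarrow> ereal) \<Rightarrow> ereal" where
  "ereal_integral M f =
     enn2ereal (\<integral>\<^sup>+ x. e2ennreal (f x) \<partial>M) - enn2ereal (\<integral>\<^sup>+ x. e2ennreal (- f x) \<partial>M)"

text \<open>
  Strategies are functions on the whole real line of which only the restriction to \<open>{0..}\<close> matters.
  The interval hull \<open>is_interval hull G\<close> is the intersection of all intervals containing \<open>G\<close>.
\<close>

definition conv_admissible ::
    "real set \<Rightarrow> real set \<Rightarrow> real \<Rightarrow> ((real \<Rightarrow> real) \<times> (real \<Rightarrow> real)) set" where
  "conv_admissible A Q x = {(\<alpha>, q).
     \<alpha> \<in> borel_measurable (restrict_space borel {0..}) \<and>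
     q \<in> borel_measurable (restrict_space borel {0..}) \<and>
     (\<forall>t\<ge>0. \<alpha> t \<in> is_interval hull A) \<and>
     (\<forall>t\<ge>0. q t \<in> is_interval hull Q) \<and>
     (\<forall>t\<ge>0. set_integrable lborel {0..t} \<alpha>) \<and>
     (\<forall>t\<ge>0. x + (LBINT s:{0..t}. \<alpha> s - q s) \<ge> 0)}"

definition conv_payoff ::
    "real \<Rightarrow> real set \<Rightarrow> real set \<Rightarrow> (real \<Rightarrow> real) \<Rightarrow> (real \<Rightarrow> real) \<Rightarrow>
     (real \<Rightarrow> real) \<times> (real \<Rightarrow> real) \<Rightarrow> ereal" where
  "conv_payoff \<beta> A Q R C = (\<lambda>(\<alpha>, q).
     ereal_integral (restrict_space lborel {0..})
       (\<lambda>t. ereal (exp (- \<beta> * t)) * (conc_revenue Q R (q t) - conv_cost A C (\<alpha> t))))"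

definition conv_value ::
    "real \<Rightarrow> real set \<Rightarrow> real set \<Rightarrow> (real \<Rightarrow> real) \<Rightarrow> (real \<Rightarrow> real) \<Rightarrow> real \<Rightarrow> ereal" where
  "conv_value \<beta> A Q R C x = (SUP s\<in>conv_admissible A Q x. conv_payoff \<beta> A Q R C s)"

text \<open>
  Probability measures on \<open>S\<close> live on the Borel space \<open>restrict_space borel S\<close>, whose underlying
  set is \<open>S\<close>.
\<close>

definition relaxed_control :: "real set \<Rightarrow> (real \<Rightarrow> real measure) \<Rightarrow> bool" where
  "relaxed_control S \<mu> \<longleftrightarrow>
     (\<forall>t\<ge>0. \<mu> t \<in> space (prob_algebra (restrict_space borel S))) \<and>
     (\<forall>\<phi>::real \<Rightarrow> real. continuous_on S \<phi> \<and> bounded (\<phi> ` S) \<longrightarrow>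
        (\<lambda>t. LINT y|\<mu> t. \<phi> y) \<in> borel_measurable (restrict_space borel {0..}))"

text \<open>
  Local integrability of the mean production rate is stated with nonnegative integrals, since
  \<open>LINT y|\<alpha> s. y\<close> is 0 when the mean is infinite; under this condition the mean is finite for
  almost every \<open>s\<close>, so the Bochner integrals in the inventory constraint are the intended ones.
\<close>

definition relaxed_admissible ::
    "real set \<Rightarrow> real set \<Rightarrow> real \<Rightarrow> ((real \<Rightarrow> real measure) \<times> (real \<Rightarrow> real measure)) set" where
  "relaxed_admissible A Q x = {(\<alpha>, q).
     relaxed_control A \<alpha> \<and> relaxed_control Q q \<and>
     (\<forall>t\<ge>0. (\<integral>\<^sup>+ s\<in>{0..t}. (\<integral>\<^sup>+ y. ennreal y \<partial>\<alpha> s) \<partial>lborel) < \<infinity>) \<and>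
     (\<forall>t\<ge>0. x + (LBINT s:{0..t}. (LINT y|\<alpha> s. y)) - (LBINT s:{0..t}. (LINT y|q s. y)) \<ge> 0)}"

text \<open>
  Revenue and cost are nonnegative. The revenue term is finite because \<open>R\<close> is bounded on the
  compact set \<open>Q\<close>; the cost term may be infinite.
\<close>

definition relaxed_payoff ::
    "real \<Rightarrow> (real \<Rightarrow> real) \<Rightarrow> (real \<Rightarrow> real) \<Rightarrow>
     (real \<Rightarrow> real measure) \<times> (real \<Rightarrow> real measure) \<Rightarrow> ereal" where
  "relaxed_payoff \<beta> R C = (\<lambda>(\<alpha>, q).
     enn2ereal (\<integral>\<^sup>+ t\<in>{0..}. ennreal (exp (- \<beta> * t)) * (\<integral>\<^sup>+ y. ennreal (R y) \<partial>q t) \<partial>lborel) -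
     enn2ereal (\<integral>\<^sup>+ t\<in>{0..}. ennreal (exp (- \<beta> * t)) * (\<integral>\<^sup>+ y. ennreal (C y) \<partial>\<alpha> t) \<partial>lborel))"

definition relaxed_value ::
    "real \<Rightarrow> real set \<Rightarrow> real set \<Rightarrow> (real \<Rightarrow> real) \<Rightarrow> (real \<Rightarrow> real) \<Rightarrow> real \<Rightarrow> ereal" where
  "relaxed_value \<beta> A Q R C x = (SUP s\<in>relaxed_admissible A Q x. relaxed_payoff \<beta> R C s)"

definition two_point_measure :: "'a measure \<Rightarrow> real \<Rightarrow> 'a \<Rightarrow> 'a \<Rightarrow> 'a measure" where
  "two_point_measure M p a b = measure_of (space M) (sets M)
     (\<lambda>B. ennreal p * emeasure (return M a) B + ennreal (1 - p) * emeasure (return M b) B)"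

lemma sets_two_point_measure [simp]: "sets (two_point_measure M p a b) = sets M"
  by (simp add: two_point_measure_def)

lemma space_two_point_measure [simp]: "space (two_point_measure M p a b) = space M"
  by (simp add: two_point_measure_def)

lemma emeasure_two_point_measure:
  assumes "B \<in> sets M"
  shows "emeasure (two_point_measure M p a b) B =
    ennreal p * emeasure (return M a) B + ennreal (1 - p) * emeasure (return M b) B"
proof (rule emeasure_measure_of[OF two_point_measure_def])
  show "sets M \<subseteq> Pow (space M)"
    by (rule sets.space_closed)
  show "B \<in> sets (two_point_measure M p a b)"
    using assms by simp
  let ?m = "\<lambda>B. ennreal p * emeasure (return M a) B + ennreal (1 - p) * emeasure (return M b) B"
  show "positive (sets (two_point_measure M p a b)) ?m"
    by (simp add: positive_def)
  show "countably_additive (sets (two_point_measure M p a b)) ?m"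
    unfolding countably_additive_def
  proof (intro allI impI)
    fix F :: "nat \<Rightarrow> 'a set"
    assume F: "range F \<subseteq> sets (two_point_measure M p a b)" "disjoint_family F"
    have s: "(\<Sum>i. emeasure (return M c) (F i)) = emeasure (return M c) (\<Union>i. F i)" for c
      using F by (intro suminf_emeasure) auto
    show "(\<Sum>i. ?m (F i)) = ?m (\<Union>i. F i)"
      by (simp add: suminf_add[symmetric] summableI ennreal_suminf_cmult s)
  qed
qed

end

theory Submission
  imports Defs
begin

text \<open>
  Start from an empty inventory. The constraint says that at each time the cumulated sales are at most
  the cumulated production. The discount factor is a mixture, with positive weights, of the indicator
  functions of the intervals from 0 to \<open>s\<close>, so the discounted sales are at most the discounted
  production (\<open>discounted_le_if_cumulated_le\<close>). It is therefore enough to know a price \<open>l \<ge> 0\<close> at which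
  no instantaneous choice of sales and production, with the imbalance \<open>q - a\<close> charged at \<open>l\<close>, is more
  profitable than \<open>u\<close>. Integrating that inequality in time shows that no strategy earns more than the
  discounted constant profit \<open>(r - c) / \<beta>\<close>, where \<open>r\<close> and \<open>c\<close> are the hulls of revenue and cost at \<open>u\<close>
  (\<open>conv_payoff_le\<close>, \<open>relaxed_payoff_le\<close>).

  The price is a Lagrange multiplier for the static problem (\<open>shadow_price\<close>). It yields the affine
  functions \<open>r + l * (q - u)\<close> above \<open>R\<close> on \<open>Q\<close> and \<open>c + l * (a - u)\<close> below \<open>C\<close> on \<open>A\<close>. Such bounds on the
  original data pass to their hulls as well as to their averages over probability measures, so the same
  two lines serve the convexified and the relaxed problem. That the price is nonnegative comes from the
  monotonicity of the cost, and that it is finite from the possibility of producing without selling.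

  The static strategies attain the bound: the constant control \<open>u\<close> earns the rate \<open>r - c\<close> in the
  convexified problem, and two-point measures with mean \<open>u\<close> and the same mean revenue and mean cost earn
  it in the relaxed problem. Such measures exist because the hulls are attained by chords. For the cost on
  an unbounded set this rests on superlinear growth, which makes chords with a far endpoint inefficient
  (\<open>conv_cost_truncate\<close>, \<open>conv_cost_attained\<close>).
\<close>

section \<open>Convex and concave hulls on the line\<close>

lemma mem_interval_hull_iff:
  fixes S :: "real set"
  shows "x \<in> is_interval hull S \<longleftrightarrow> (\<exists>a\<in>S. \<exists>b\<in>S. a \<le> x \<and> x \<le> b)"
proof -
  let ?H = "{x. \<exists>a\<in>S. \<exists>b\<in>S. a \<le> x \<and> x \<le> b}"
  have "is_interval hull S = ?H"
  proof (rule hull_unique)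
    show "is_interval ?H"
      unfolding is_interval_1 by (blast intro: order_trans)
    show "?H \<subseteq> T" if "S \<subseteq> T" "is_interval T" for T
      using that unfolding is_interval_1 by blast
  qed auto
  then show ?thesis by simp
qed

lemma convex_combination_mem_interval_hull:
  fixes S :: "real set" and \<delta> :: real
  assumes "a \<in> S" "b \<in> S" "0 \<le> \<delta>" "\<delta> \<le> 1"
  shows "\<delta> * a + (1 - \<delta>) * b \<in> is_interval hull S"
proof -
  have "0 \<le> (1 - \<delta>) * \<bar>b - a\<bar>" "0 \<le> \<delta> * \<bar>b - a\<bar>"
    using assms by auto
  then have "min a b \<le> \<delta> * a + (1 - \<delta>) * b" "\<delta> * a + (1 - \<delta>) * b \<le> max a b"
    by (auto simp: min_def max_def algebra_simps)
  then show ?thesis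
    unfolding mem_interval_hull_iff using assms(1,2)
    by (intro bexI[of _ "min a b"] bexI[of _ "max a b"]) (auto simp: min_def max_def)
qed

text \<open>
  On real data the extended-valued hull is an infimum of real numbers: the heights over \<open>x\<close> of
  the chords of the graph of \<open>f\<close> over \<open>S\<close>.
\<close>

definition chord_values :: "real set \<Rightarrow> (real \<Rightarrow> real) \<Rightarrow> real \<Rightarrow> real set" where
  "chord_values S f x = {\<delta> * f a + (1 - \<delta>) * f b | \<delta> a b.
     0 \<le> \<delta> \<and> \<delta> \<le> 1 \<and> a \<in> S \<and> b \<in> S \<and> \<delta> * a + (1 - \<delta>) * b = x}"

lemma conv_cost_eq_Inf_chord_values: "conv_cost S f x = Inf (ereal ` chord_values S f x)"
proof -
  let ?F = "\<lambda>a. if a \<in> S then ereal (f a) else \<infinity>"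
  have dom: "eff_dom ?F = S"
    by (auto simp: eff_dom_def)
  show ?thesis
    unfolding conv_cost_def convex_fun_hull_def dom chord_values_def
    by (rule arg_cong[where f = Inf]) (force simp: image_def)
qed

lemma conc_revenue_eq: "conc_revenue S f x = - conv_cost S (\<lambda>y. - f y) x"
proof -
  have "(\<lambda>z. - (if z \<in> S then ereal (f z) else -\<infinity>)) = (\<lambda>z. if z \<in> S then ereal (- f z) else \<infinity>)"
    by auto
  then show ?thesis
    unfolding conc_revenue_def conv_cost_def by metis
qed

text \<open>
  Two estimates carry the comparison of strategies: a hull is bounded on one side by each chord, and
  on the other side by each affine function that bounds the data. Both come directly from the infimum.
\<close>

lemma conv_cost_le_chord:
  fixes \<delta> :: real
  assumes "a \<in> S" "b \<in> S" "0 \<le> \<delta>" "\<delta> \<le> 1"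
  shows "conv_cost S f (\<delta> * a + (1 - \<delta>) * b) \<le> ereal (\<delta> * f a + (1 - \<delta>) * f b)"
  unfolding conv_cost_eq_Inf_chord_values
  by (rule Inf_lower) (use assms in \<open>auto simp: chord_values_def\<close>)

lemma conc_revenue_ge_chord:
  fixes \<delta> :: real
  assumes "a \<in> S" "b \<in> S" "0 \<le> \<delta>" "\<delta> \<le> 1"
  shows "ereal (\<delta> * f a + (1 - \<delta>) * f b) \<le> conc_revenue S f (\<delta> * a + (1 - \<delta>) * b)"
proof -
  have "- ereal (\<delta> * - f a + (1 - \<delta>) * - f b) \<le> conc_revenue S f (\<delta> * a + (1 - \<delta>) * b)"
    unfolding conc_revenue_eq ereal_minus_le_minus by (rule conv_cost_le_chord[OF assms])
  then show ?thesis by (simp add: add.commute)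
qed

lemma conv_cost_ge_affine:
  assumes "\<And>a. a \<in> S \<Longrightarrow> k + l * a \<le> f a"
  shows "ereal (k + l * x) \<le> conv_cost S f x"
  unfolding conv_cost_eq_Inf_chord_values
proof (rule Inf_greatest, clarsimp simp: chord_values_def)
  fix \<delta> a b :: real assume *: "0 \<le> \<delta>" "\<delta> \<le> 1" "a \<in> S" "b \<in> S"
  have "\<delta> * (k + l * a) + (1 - \<delta>) * (k + l * b) \<le> \<delta> * f a + (1 - \<delta>) * f b"
    using * by (intro add_mono mult_left_mono assms) auto
  then show "k + l * (\<delta> * a + (1 - \<delta>) * b) \<le> \<delta> * f a + (1 - \<delta>) * f b"
    by (simp add: algebra_simps)
qed

lemma conc_revenue_le_affine:
  assumes "\<And>a. a \<in> S \<Longrightarrow> f a \<le> k + l * a"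
  shows "conc_revenue S f x \<le> ereal (k + l * x)"
proof -
  have "ereal (- k + - l * x) \<le> conv_cost S (\<lambda>y. - f y) x"
    by (rule conv_cost_ge_affine) (use assms in force)
  then have "conc_revenue S f x \<le> - ereal (- k + - l * x)"
    unfolding conc_revenue_eq ereal_minus_le_minus .
  then show ?thesis by (simp add: add.commute)
qed

text \<open>
  The chords over \<open>x\<close> are parametrized by a compact set of triples (weight, endpoint, endpoint), on
  which the height is continuous.
\<close>

lemma conv_cost_attained_compact:
  assumes S: "compact S" and f: "continuous_on S f" and x: "x \<in> is_interval hull S"
  obtains \<delta> a b where "\<delta> \<in> {0<..<1}" "a \<in> S" "b \<in> S" "x = \<delta> * a + (1 - \<delta>) * b"
    "conv_cost S f x = ereal (\<delta> * f a + (1 - \<delta>) * f b)"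
proof -
  define K where "K = ({0..1} \<times> S \<times> S) \<inter> {(\<delta>, a, b). \<delta> * a + (1 - \<delta>) * b = x}"
  define g where "g = (\<lambda>(\<delta>, a, b). \<delta> * f a + (1 - \<delta>) * f b)"
  have "closed {(\<delta>, a, b). \<delta> * a + (1 - \<delta>) * b = x}"
    unfolding split_def by (intro closed_Collect_eq continuous_intros)
  then have "compact K"
    unfolding K_def using S by (intro compact_Int_closed compact_Times) auto
  moreover have "K \<noteq> {}"
  proof -
    obtain a b where ab: "a \<in> S" "b \<in> S" "a \<le> x" "x \<le> b"
      using x by (auto simp: mem_interval_hull_iff)
    then have "x \<in> closed_segment b a"
      by (simp add: closed_segment_eq_real_ivl)
    then obtain \<delta> where "0 \<le> \<delta>" "\<delta> \<le> 1" "x = (1 - \<delta>) * b + \<delta> * a"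
      by (auto simp: closed_segment_def)
    then have "(\<delta>, a, b) \<in> K"
      using ab by (auto simp: K_def)
    then show ?thesis by auto
  qed
  moreover have "continuous_on K g"
    unfolding g_def split_def K_def
    by (intro continuous_intros continuous_on_compose2[OF f]) auto
  ultimately obtain p where p: "p \<in> K" and min: "\<And>p'. p' \<in> K \<Longrightarrow> g p \<le> g p'"
    using continuous_attains_inf by metis
  obtain \<delta> a b where p_eq: "p = (\<delta>, a, b)" by (cases p)
  have val: "conv_cost S f x = ereal (\<delta> * f a + (1 - \<delta>) * f b)"
  proof (rule antisym)
    show "conv_cost S f x \<le> ereal (\<delta> * f a + (1 - \<delta>) * f b)"
      using conv_cost_le_chord[of a S b \<delta> f] p by (auto simp: K_def p_eq)
    show "ereal (\<delta> * f a + (1 - \<delta>) * f b) \<le> conv_cost S f x"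
      unfolding conv_cost_eq_Inf_chord_values
    proof (rule Inf_greatest, clarsimp simp: chord_values_def)
      fix \<delta>' a' b' assume "0 \<le> \<delta>'" "\<delta>' \<le> 1" "a' \<in> S" "b' \<in> S" "x = \<delta>' * a' + (1 - \<delta>') * b'"
      then show "\<delta> * f a + (1 - \<delta>) * f b \<le> \<delta>' * f a' + (1 - \<delta>') * f b'"
        using min[of "(\<delta>', a', b')"] by (auto simp: K_def g_def p_eq)
    qed
  qed
  have mem: "0 \<le> \<delta>" "\<delta> \<le> 1" "a \<in> S" "b \<in> S" "\<delta> * a + (1 - \<delta>) * b = x"
    using p by (auto simp: K_def p_eq)
  \<comment> \<open>A degenerate minimizing chord is the single point \<open>x\<close>, which any weight represents.\<close>
  consider "\<delta> = 0" | "\<delta> = 1" | "\<delta> \<in> {0<..<1}"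
    using mem by force
  then show ?thesis
  proof cases
    case 1
    then show ?thesis using that[of "1/2" b b] mem val by auto
  next
    case 2
    then show ?thesis using that[of "1/2" a a] mem val by auto
  next
    case 3
    then show ?thesis using that mem val by auto
  qed
qed

text \<open>
  On an unbounded \<open>A\<close> far endpoints can be discarded. Fix \<open>b \<in> A\<close> to the right of \<open>x + 1\<close>. The slope
  of a chord from a point \<open>a1 \<le> x\<close> to \<open>b\<close> is at most \<open>C b\<close>, since the run is at least 1 and the rise at
  most \<open>C b\<close>. By superlinear growth the slope from \<open>a1\<close> to a far point is at least \<open>C b\<close>, so
  replacing the far endpoint by \<open>b\<close> does not raise the chord at \<open>x\<close>.
\<close>

lemma conv_cost_truncate:
  assumes A: "A \<subseteq> {0..}" and nonneg: "\<And>a. a \<in> A \<Longrightarrow> C a \<ge> 0" and mono: "mono_on A C"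
    and unb: "\<not> bounded A" and growth: "filterlim (\<lambda>a. C a / a) at_top (inf at_top (principal A))"
    and x: "x \<in> is_interval hull A"
  obtains M where "x \<in> is_interval hull (A \<inter> {..M})" "conv_cost A C x = conv_cost (A \<inter> {..M}) C x"
proof -
  have "\<exists>b\<in>A. x + 1 \<le> b"
  proof (rule ccontr)
    assume "\<not> ?thesis"
    then have "A \<subseteq> {0..x + 1}" using A by force
    then show False using unb bounded_closed_interval bounded_subset by blast
  qed
  then obtain b where b: "b \<in> A" "x + 1 \<le> b" by blast
  have "\<forall>\<^sub>F a in inf at_top (principal A). 2 * C b \<le> C a / a"
    using growth by (simp add: filterlim_at_top)
  then obtain N where N: "\<And>a. a \<ge> N \<Longrightarrow> a \<in> A \<Longrightarrow> 2 * C b \<le> C a / a"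
    by (auto simp: eventually_inf_principal eventually_at_top_linorder)
  define M where "M = Max {N, b, 1}"
  have M: "N \<le> M" "b \<le> M" "1 \<le> M" by (auto simp: M_def)
  \<comment> \<open>The factor 2 above leaves room for subtracting \<open>C a1 \<le> C b\<close> from \<open>C a2\<close>.\<close>
  have shorten: "\<exists>v'\<in>chord_values (A \<inter> {..M}) C x. v' \<le> \<delta> * C a1 + (1 - \<delta>) * C a2"
    if chord: "0 \<le> \<delta>" "\<delta> \<le> 1" "a1 \<in> A" "a2 \<in> A" "\<delta> * a1 + (1 - \<delta>) * a2 = x" and le: "a1 \<le> a2"
    for \<delta> a1 a2
  proof (cases "a2 \<le> M")
    case True
    then have "\<delta> * C a1 + (1 - \<delta>) * C a2 \<in> chord_values (A \<inter> {..M}) C x"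
      unfolding chord_values_def mem_Collect_eq
      using chord le by (intro exI[of _ \<delta>] exI[of _ a1] exI[of _ a2]) auto
    then show ?thesis by blast
  next
    case False
    have x_a1: "x - a1 = (1 - \<delta>) * (a2 - a1)"
      using chord by (simp add: algebra_simps)
    then have a1: "0 \<le> a1" "a1 \<le> x"
      using chord le A by (auto intro: diff_ge_0_iff_ge[THEN iffD1])
    define p where "p = (x - a1) / (b - a1)"
    have p: "0 \<le> p" "p \<le> x - a1" "p \<le> 1"
      using a1 b by (auto simp: p_def divide_simps mult_le_cancel_left1)
    have p_eq: "(1 - p) * a1 + (1 - (1 - p)) * b = x"
    proof -
      have "p * (b - a1) = x - a1" using a1 b by (simp add: p_def)
      then show ?thesis by (simp add: algebra_simps)
    qed
    have Cb: "C a1 \<le> C b" "0 \<le> C a1" "0 \<le> C b"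
      using mono_onD[OF mono, of a1 b] chord a1 b nonneg by auto
    have "2 * C b * a2 \<le> C a2"
      using N[of a2] False M chord by (simp add: field_simps)
    moreover have "C b \<le> C b * a2"
      using False M Cb by (simp add: mult_le_cancel_left1)
    ultimately have steep: "C b * a2 \<le> C a2 - C a1"
      using Cb by linarith
    have "p * (C b - C a1) \<le> (x - a1) * C b"
      using p Cb by (intro mult_mono) auto
    also have "\<dots> = (1 - \<delta>) * ((a2 - a1) * C b)"
      using x_a1 by simp
    also have "\<dots> \<le> (1 - \<delta>) * (C b * a2)"
      using chord a1 Cb by (intro mult_left_mono) (auto simp: algebra_simps)
    also have "\<dots> \<le> (1 - \<delta>) * (C a2 - C a1)"
      using chord steep by (intro mult_left_mono) auto
    finally have "(1 - p) * C a1 + (1 - (1 - p)) * C b \<le> \<delta> * C a1 + (1 - \<delta>) * C a2"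
      by (simp add: algebra_simps)
    moreover have "(1 - p) * C a1 + (1 - (1 - p)) * C b \<in> chord_values (A \<inter> {..M}) C x"
      unfolding chord_values_def mem_Collect_eq
      using p p_eq chord a1 b M by (intro exI[of _ "1 - p"] exI[of _ a1] exI[of _ b]) auto
    ultimately show ?thesis by blast
  qed
  have dominated: "\<exists>v'\<in>chord_values (A \<inter> {..M}) C x. v' \<le> v" if v: "v \<in> chord_values A C x" for v
  proof -
    obtain \<delta> a1 a2 where chord: "v = \<delta> * C a1 + (1 - \<delta>) * C a2" "0 \<le> \<delta>" "\<delta> \<le> 1" "a1 \<in> A" "a2 \<in> A"
        "\<delta> * a1 + (1 - \<delta>) * a2 = x"
      using v by (auto simp: chord_values_def)
    show ?thesis
    proof (cases "a1 \<le> a2")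
      case True
      then show ?thesis using shorten chord by metis
    next
      case False
      then show ?thesis using shorten[of "1 - \<delta>" a2 a1] chord by (simp add: add.commute)
    qed
  qed
  have "conv_cost A C x = conv_cost (A \<inter> {..M}) C x"
    unfolding conv_cost_eq_Inf_chord_values
  proof (rule antisym)
    show "Inf (ereal ` chord_values A C x) \<le> Inf (ereal ` chord_values (A \<inter> {..M}) C x)"
      by (rule Inf_superset_mono) (auto simp: chord_values_def)
    show "Inf (ereal ` chord_values (A \<inter> {..M}) C x) \<le> Inf (ereal ` chord_values A C x)"
      by (rule Inf_mono) (use dominated in force)
  qed
  moreover have "x \<in> is_interval hull (A \<inter> {..M})"
  proof -
    obtain a where "a \<in> A" "a \<le> x" using x by (auto simp: mem_interval_hull_iff)
    then show ?thesis
      unfolding mem_interval_hull_iff using b M by (intro bexI[of _ a] bexI[of _ b]) auto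
  qed
  ultimately show ?thesis using that by blast
qed

lemma conv_cost_attained:
  assumes "closed A" "A \<subseteq> {0..}" "continuous_on A C" "\<And>a. a \<in> A \<Longrightarrow> C a \<ge> 0" "mono_on A C"
    and growth: "\<not> bounded A \<Longrightarrow> filterlim (\<lambda>a. C a / a) at_top (inf at_top (principal A))"
    and x: "x \<in> is_interval hull A"
  obtains \<nu> a b where "\<nu> \<in> {0<..<1}" "a \<in> A" "b \<in> A" "x = \<nu> * a + (1 - \<nu>) * b"
    "conv_cost A C x = ereal (\<nu> * C a + (1 - \<nu>) * C b)"
proof (cases "bounded A")
  case True
  then have "compact A"
    using assms(1) by (simp add: compact_eq_bounded_closed)
  from conv_cost_attained_compact[OF this assms(3) x] that show ?thesis
    by blast
next
  case False
  obtain M where M: "x \<in> is_interval hull (A \<inter> {..M})"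
      "conv_cost A C x = conv_cost (A \<inter> {..M}) C x"
    by (rule conv_cost_truncate[OF assms(2,4,5) False growth[OF False] x])
  have "A \<inter> {..M} \<subseteq> {0..M}" using assms(2) by auto
  then have "bounded (A \<inter> {..M})"
    using bounded_closed_interval bounded_subset by blast
  then have cpt: "compact (A \<inter> {..M})"
    using assms(1) by (simp add: compact_eq_bounded_closed closed_Int)
  have "continuous_on (A \<inter> {..M}) C"
    using assms(3) continuous_on_subset by blast
  from conv_cost_attained_compact[OF cpt this M(1)] show ?thesis
    using that M(2) by (metis IntD1)
qed

lemma conc_revenue_attained:
  assumes "compact Q" "continuous_on Q R" "x \<in> is_interval hull Q"
  obtains \<gamma> a b where "\<gamma> \<in> {0<..<1}" "a \<in> Q" "b \<in> Q" "x = \<gamma> * a + (1 - \<gamma>) * b"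
    "conc_revenue Q R x = ereal (\<gamma> * R a + (1 - \<gamma>) * R b)"
proof -
  have "continuous_on Q (\<lambda>y. - R y)"
    using assms(2) by (intro continuous_intros)
  from conv_cost_attained_compact[OF assms(1) this assms(3)]
  obtain \<gamma> a b where *: "\<gamma> \<in> {0<..<1}" "a \<in> Q" "b \<in> Q" "x = \<gamma> * a + (1 - \<gamma>) * b"
    "conv_cost Q (\<lambda>y. - R y) x = ereal (\<gamma> * - R a + (1 - \<gamma>) * - R b)"
    by blast
  have "conc_revenue Q R x = ereal (- (\<gamma> * - R a + (1 - \<gamma>) * - R b))"
    unfolding conc_revenue_eq *(5) by simp
  also have "- (\<gamma> * - R a + (1 - \<gamma>) * - R b) = \<gamma> * R a + (1 - \<gamma>) * R b"
    by simp
  finally show ?thesis by (rule that[OF *(1-4)])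
qed

section \<open>The shadow price\<close>

text \<open>
  A Lagrange multiplier \<open>l\<close> for the constraint that sales do not exceed production. For a pair \<open>(q, a)\<close>
  write \<open>d = q - a\<close> and \<open>w = R q - C a\<close>; the line of slope \<open>l\<close> through \<open>(0, r - c)\<close> has to lie above all
  points \<open>(d, w)\<close>. Points with \<open>d \<le> 0\<close> have \<open>w \<le> r - c\<close>: lowering production from \<open>a\<close> to \<open>q\<close>, by mixing
  it with 0, does not raise the cost. So the points with \<open>d < 0\<close> bound \<open>l\<close> from
  above by nonnegative numbers, whose infimum is taken as \<open>l\<close>. It is also large enough for the points with \<open>d > 0\<close>: mixing one point from each side so
  that the mean of \<open>d\<close> is 0 makes mean sales equal to mean production, and at this common mean the
  optimality of \<open>u\<close> bounds the mean of \<open>w\<close> by \<open>r - c\<close>.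

  The inequality \<open>R q - C a \<le> r - c + l * (q - a)\<close> then separates into one support line for \<open>R\<close> and
  one for \<open>C\<close>, by reading it as an affine bound in one variable and evaluating the hull at \<open>u\<close>.
\<close>

lemma shadow_price:
  assumes A: "A \<subseteq> {0..}" "0 \<in> A" "A - {0} \<noteq> {}" and mono: "mono_on A C"
    and Q: "Q \<subseteq> {0..}" "0 \<in> Q"
    and r: "conc_revenue Q R u = ereal r" and c: "conv_cost A C u = ereal c"
    and max: "\<And>w. w \<in> is_interval hull Q \<inter> is_interval hull A \<Longrightarrow>
      conc_revenue Q R w - conv_cost A C w \<le> ereal (r - c)"
  obtains l where "0 \<le> l" "\<And>q. q \<in> Q \<Longrightarrow> R q \<le> r + l * (q - u)" "\<And>a. a \<in> A \<Longrightarrow> c + l * (a - u) \<le> C a"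
proof -
  have balanced: "(\<delta> * R q1 + (1 - \<delta>) * R q2) - (\<epsilon> * C a1 + (1 - \<epsilon>) * C a2) \<le> r - c"
    if "q1 \<in> Q" "q2 \<in> Q" "a1 \<in> A" "a2 \<in> A" "0 \<le> \<delta>" "\<delta> \<le> 1" "0 \<le> \<epsilon>" "\<epsilon> \<le> 1"
      and eq: "\<delta> * q1 + (1 - \<delta>) * q2 = \<epsilon> * a1 + (1 - \<epsilon>) * a2" for q1 q2 a1 a2 \<delta> \<epsilon>
  proof -
    let ?w = "\<delta> * q1 + (1 - \<delta>) * q2"
    have "ereal (\<delta> * R q1 + (1 - \<delta>) * R q2) - ereal (\<epsilon> * C a1 + (1 - \<epsilon>) * C a2)
        \<le> conc_revenue Q R ?w - conv_cost A C ?w"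
      using conc_revenue_ge_chord[of q1 Q q2 \<delta> R] conv_cost_le_chord[of a1 A a2 \<epsilon> C] that
      by (intro ereal_minus_mono) auto
    also have "\<dots> \<le> ereal (r - c)"
      using that convex_combination_mem_interval_hull[of q1 Q q2 \<delta>]
        convex_combination_mem_interval_hull[of a1 A a2 \<epsilon>]
      by (intro max) auto
    finally show ?thesis by simp
  qed
  have surplus: "R q - C a \<le> r - c" if "q \<in> Q" "a \<in> A" "q \<le> a" for q a
  proof -
    have pos: "0 \<le> q" "0 \<le> a" using that A Q by auto
    \<comment> \<open>If \<open>a = 0\<close> then \<open>q = 0\<close> and any weight represents \<open>q\<close> by \<open>a\<close> and 0.\<close>
    define \<epsilon> where "\<epsilon> = (if a = 0 then 1 else q / a)"
    have \<epsilon>: "0 \<le> \<epsilon>" "\<epsilon> \<le> 1" "q = \<epsilon> * a + (1 - \<epsilon>) * 0"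
      using pos that by (auto simp: \<epsilon>_def divide_simps)
    have "R q - (\<epsilon> * C a + (1 - \<epsilon>) * C 0) \<le> r - c"
      using balanced[of q q a 0 1 \<epsilon>] that A \<epsilon> by simp
    moreover have "(1 - \<epsilon>) * C 0 \<le> (1 - \<epsilon>) * C a"
      using mono_onD[OF mono, of 0 a] that A pos \<epsilon> by (intro mult_left_mono) auto
    ultimately show ?thesis by (simp add: algebra_simps)
  qed
  define L where "L = {(r - c - (R q - C a)) / (a - q) | q a. q \<in> Q \<and> a \<in> A \<and> q < a}"
  define l where "l = Inf L"
  have L0: "0 \<le> y" if "y \<in> L" for y
    using that surplus by (auto simp: L_def intro!: divide_nonneg_nonneg)
  then have bdd: "bdd_below L" by (auto simp: bdd_below_def)
  obtain a0 where "a0 \<in> A" "0 < a0" using A by force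
  then have ne: "L \<noteq> {}" using Q unfolding L_def by blast
  have l0: "0 \<le> l"
    unfolding l_def using ne L0 by (intro cInf_greatest) auto
  have price: "R q - C a \<le> r - c + l * (q - a)" if qa: "q \<in> Q" "a \<in> A" for q a
  proof -
    consider "q < a" | "q = a" | "a < q" by linarith
    then show ?thesis
    proof cases
      case 1
      then have "l \<le> (r - c - (R q - C a)) / (a - q)"
        unfolding l_def using qa bdd by (intro cInf_lower) (auto simp: L_def)
      then show ?thesis using 1 by (simp add: field_simps)
    next
      case 2
      then show ?thesis using surplus qa by auto
    next
      case 3
      have "(R q - C a - (r - c)) / (q - a) \<le> l"
        unfolding l_def
      proof (rule cInf_greatest[OF ne])
        fix y assume "y \<in> L"
        then obtain q' a' where y: "y = (r - c - (R q' - C a')) / (a' - q')" "q' \<in> Q" "a' \<in> A" "q' < a'"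
          by (auto simp: L_def)
        define S where "S = (q - a) + (a' - q')"
        define \<theta> where "\<theta> = (q - a) / S"
        have S: "0 < S" using 3 y by (simp add: S_def)
        have t: "\<theta> * S = q - a" "(1 - \<theta>) * S = a' - q'"
          using S by (auto simp: \<theta>_def S_def field_simps)
        have t01: "0 \<le> \<theta>" "\<theta> \<le> 1"
          using S 3 y by (auto simp: \<theta>_def S_def)
        have "(\<theta> * q' + (1 - \<theta>) * q - (\<theta> * a' + (1 - \<theta>) * a)) * S
            = (\<theta> * S) * (q' - a') + ((1 - \<theta>) * S) * (q - a)"
          by (simp add: algebra_simps)
        also have "\<dots> = 0" unfolding t by (simp add: algebra_simps)
        finally have "\<theta> * q' + (1 - \<theta>) * q = \<theta> * a' + (1 - \<theta>) * a"
          using S by simp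
        then have "(\<theta> * R q' + (1 - \<theta>) * R q) - (\<theta> * C a' + (1 - \<theta>) * C a) \<le> r - c"
          using balanced y qa t01 by blast
        then have "((\<theta> * R q' + (1 - \<theta>) * R q) - (\<theta> * C a' + (1 - \<theta>) * C a)) * S \<le> (r - c) * S"
          using S by simp
        moreover have "((\<theta> * R q' + (1 - \<theta>) * R q) - (\<theta> * C a' + (1 - \<theta>) * C a)) * S
            = (\<theta> * S) * (R q' - C a') + ((1 - \<theta>) * S) * (R q - C a)"
          by (simp add: algebra_simps)
        ultimately have "(q - a) * (R q' - C a') + (a' - q') * (R q - C a) \<le> (r - c) * S"
          unfolding t by simp
        then have "(R q - C a - (r - c)) * (a' - q') \<le> (r - c - (R q' - C a')) * (q - a)"
          unfolding S_def by (simp add: algebra_simps)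
        moreover have "0 < q - a" "0 < a' - q'"
          using 3 y by auto
        ultimately show "(R q - C a - (r - c)) / (q - a) \<le> y"
          unfolding y(1) by (simp only: pos_divide_le_eq times_divide_eq_left pos_le_divide_eq)
      qed
      then show ?thesis using 3 by (simp add: field_simps)
    qed
  qed
  show ?thesis
  proof (rule that[OF l0])
    fix q assume q: "q \<in> Q"
    have "ereal ((R q - (r - c) - l * q) + l * u) \<le> conv_cost A C u"
      by (rule conv_cost_ge_affine) (use price[OF q] in \<open>force simp: algebra_simps\<close>)
    then show "R q \<le> r + l * (q - u)"
      by (simp add: c algebra_simps)
  next
    fix a assume a: "a \<in> A"
    have "conc_revenue Q R u \<le> ereal ((C a + (r - c) - l * a) + l * u)"
      by (rule conc_revenue_le_affine) (use price[OF _ a] in \<open>force simp: algebra_simps\<close>)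
    then show "c + l * (a - u) \<le> C a"
      by (simp add: r algebra_simps)
  qed
qed

section \<open>Two-point measures\<close>

text \<open>
  As the law of a biased choice between \<open>a\<close> and \<open>b\<close>, a two-point measure inherits its total mass and
  its integrals from the Bernoulli distribution.
\<close>

lemma two_point_measure_eq_distr:
  assumes p: "0 \<le> p" "p \<le> 1" and ab: "a \<in> space M" "b \<in> space M"
  shows "two_point_measure M p a b =
    distr (measure_pmf (bernoulli_pmf p)) M (\<lambda>h. if h then a else b)"
proof (rule measure_eqI)
  fix B assume "B \<in> sets (two_point_measure M p a b)"
  then have B: "B \<in> sets M" by simp
  have "emeasure (distr (measure_pmf (bernoulli_pmf p)) M (\<lambda>h. if h then a else b)) B
      = (\<integral>\<^sup>+ x. indicator B x \<partial>distr (measure_pmf (bernoulli_pmf p)) M (\<lambda>h. if h then a else b))"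
    using B by simp
  also have "\<dots> = (\<integral>\<^sup>+ h. indicator B (if h then a else b) \<partial>measure_pmf (bernoulli_pmf p))"
    using B ab by (intro nn_integral_distr) auto
  also have "\<dots> = ennreal p * indicator B a + ennreal (1 - p) * indicator B b"
    using p by (simp add: mult.commute)
  finally show "emeasure (two_point_measure M p a b) B =
      emeasure (distr (measure_pmf (bernoulli_pmf p)) M (\<lambda>h. if h then a else b)) B"
    using B by (simp add: emeasure_two_point_measure)
qed simp

lemma two_point_measure_in_prob_algebra:
  assumes "0 \<le> p" "p \<le> 1" "a \<in> space M" "b \<in> space M"
  shows "two_point_measure M p a b \<in> space (prob_algebra M)"
  using assms by (auto simp: space_prob_algebra two_point_measure_eq_distr
      intro!: measure_pmf.prob_space_distr)

lemma nn_integral_two_point_measure: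
  assumes "0 \<le> p" "p \<le> 1" "a \<in> space M" "b \<in> space M" "f \<in> borel_measurable M"
    and "0 \<le> f a" "0 \<le> f b"
  shows "(\<integral>\<^sup>+ x. ennreal (f x) \<partial>two_point_measure M p a b) = ennreal (p * f a + (1 - p) * f b)"
  using assms
  by (simp add: two_point_measure_eq_distr nn_integral_distr ennreal_plus ennreal_mult' mult.commute)

lemma integral_two_point_measure:
  fixes f :: "'a \<Rightarrow> real"
  assumes "0 \<le> p" "p \<le> 1" "a \<in> space M" "b \<in> space M" "f \<in> borel_measurable M"
  shows "(LINT x|two_point_measure M p a b. f x) = p * f a + (1 - p) * f b"
  using assms by (simp add: two_point_measure_eq_distr integral_distr)

section \<open>Discounted integrals and cumulated flows\<close>

definition discounted :: "real \<Rightarrow> (real \<Rightarrow> ennreal) \<Rightarrow> ennreal" where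
  "discounted \<beta> f = (\<integral>\<^sup>+ t\<in>{0..}. ennreal (exp (- \<beta> * t)) * f t \<partial>lborel)"

lemma borel_measurable_half_line_iff:
  fixes f :: "real \<Rightarrow> ennreal"
  shows "f \<in> borel_measurable (restrict_space borel {0..}) \<longleftrightarrow>
    (\<lambda>t. f t * indicator {0..} t) \<in> borel_measurable borel"
  by (rule borel_measurable_restrict_space_iff_ennreal) simp

lemma nn_integral_exp_tail:
  fixes \<beta> :: real assumes "0 < \<beta>"
  shows "(\<integral>\<^sup>+ s. ennreal (\<beta> * exp (- \<beta> * s)) * indicator {t..} s \<partial>lborel) = ennreal (exp (- \<beta> * t))"
proof -
  have "(\<integral>\<^sup>+ s. ennreal (\<beta> * exp (- \<beta> * s)) * indicator {t..} s \<partial>lborel)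
      = ennreal (0 - (- exp (- \<beta> * t)))"
  proof (rule nn_integral_FTC_atLeast)
    show "((\<lambda>s. - exp (- \<beta> * s)) \<longlongrightarrow> 0) at_top"
      using assms by real_asymp
  qed (use assms in \<open>auto intro!: derivative_eq_intros\<close>)
  then show ?thesis by simp
qed

lemma discounted_mono:
  assumes "\<And>t. 0 \<le> t \<Longrightarrow> f t \<le> g t"
  shows "discounted \<beta> f \<le> discounted \<beta> g"
  unfolding discounted_def using assms
  by (intro nn_integral_mono) (auto simp: indicator_def intro!: mult_left_mono)

lemma discounted_affine:
  assumes "0 < \<beta>" and f: "f \<in> borel_measurable (restrict_space borel {0..})"
  shows "discounted \<beta> (\<lambda>t. k + l * f t) = k / ennreal \<beta> + l * discounted \<beta> f"
proof -
  let ?e = "\<lambda>t. ennreal (exp (- \<beta> * t)) * indicator {0..} t"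
  have [measurable]: "(\<lambda>t. f t * indicator {0..} t) \<in> borel_measurable borel"
    using f borel_measurable_half_line_iff by blast
  have "ennreal \<beta> * (\<integral>\<^sup>+ t. ?e t \<partial>lborel) = (\<integral>\<^sup>+ t. ennreal (\<beta> * exp (- \<beta> * t)) * indicator {0..} t \<partial>lborel)"
    using assms(1) by (subst nn_integral_cmult[symmetric]) (auto simp: ennreal_mult' mult.assoc)
  also have "\<dots> = 1"
    using nn_integral_exp_tail[OF assms(1), of 0] by simp
  finally have e: "(\<integral>\<^sup>+ t. ?e t \<partial>lborel) = 1 / ennreal \<beta>"
    using assms(1) by (metis ennreal_zero_less_divide ennreal_neq_top mult.commute
        ennreal_mult_divide_eq mult_zero_left zero_neq_one)
  have "discounted \<beta> (\<lambda>t. k + l * f t)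
      = (\<integral>\<^sup>+ t. k * ?e t + l * (ennreal (exp (- \<beta> * t)) * (f t * indicator {0..} t)) \<partial>lborel)"
    unfolding discounted_def by (intro nn_integral_cong) (auto simp: algebra_simps indicator_def)
  also have "\<dots> = k * (1 / ennreal \<beta>) + l * discounted \<beta> f"
    unfolding discounted_def e[symmetric]
    by (subst nn_integral_add) (auto simp: nn_integral_cmult mult.assoc)
  finally show ?thesis by (simp add: ennreal_times_divide)
qed

lemma discounted_const: "0 < \<beta> \<Longrightarrow> discounted \<beta> (\<lambda>t. k) = k / ennreal \<beta>"
  using discounted_affine[of \<beta> "\<lambda>t. 0" k 0] by simp

text \<open>
  Integration by parts for nonnegative integrands, where both sides may be infinite: write the
  discount factor as
  \<open>exp (- \<beta> * t) = (\<integral>s\<ge>t. \<beta> * exp (- \<beta> * s))\<close> and exchange the integrals by Tonelli's theorem.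
\<close>

lemma discounted_eq_cumulated:
  assumes \<beta>: "0 < \<beta>" and f: "f \<in> borel_measurable (restrict_space borel {0..})"
  shows "discounted \<beta> f =
    (\<integral>\<^sup>+ s\<in>{0..}. ennreal (\<beta> * exp (- \<beta> * s)) * (\<integral>\<^sup>+ t\<in>{0..s}. f t \<partial>lborel) \<partial>lborel)"
proof -
  define g where "g = (\<lambda>t. f t * indicator {0..} t)"
  have g[measurable]: "g \<in> borel_measurable borel"
    using f borel_measurable_half_line_iff unfolding g_def by blast
  define h where "h t s = g t * (ennreal (\<beta> * exp (- \<beta> * s)) * (if t \<le> s then 1 else 0))" for t s
  have [measurable]: "(\<lambda>(t, s). h t s) \<in> borel_measurable (lborel \<Otimes>\<^sub>M lborel)"
    unfolding h_def by measurable
  have "discounted \<beta> f = (\<integral>\<^sup>+ t. g t * ennreal (exp (- \<beta> * t)) \<partial>lborel)"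
    unfolding discounted_def g_def by (intro nn_integral_cong) (simp add: mult_ac)
  also have "\<dots> = (\<integral>\<^sup>+ t. \<integral>\<^sup>+ s. h t s \<partial>lborel \<partial>lborel)"
  proof (rule nn_integral_cong)
    fix t
    have "(\<integral>\<^sup>+ s. h t s \<partial>lborel) =
        g t * (\<integral>\<^sup>+ s. ennreal (\<beta> * exp (- \<beta> * s)) * indicator {t..} s \<partial>lborel)"
      unfolding h_def by (subst nn_integral_cmult[symmetric])
        (auto simp: indicator_def intro!: nn_integral_cong)
    then show "g t * ennreal (exp (- \<beta> * t)) = (\<integral>\<^sup>+ s. h t s \<partial>lborel)"
      by (simp only: nn_integral_exp_tail[OF \<beta>])
  qed
  also have "\<dots> = (\<integral>\<^sup>+ s. \<integral>\<^sup>+ t. h t s \<partial>lborel \<partial>lborel)"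
    by (rule lborel_pair.Fubini') measurable
  also have "\<dots> = (\<integral>\<^sup>+ s\<in>{0..}. ennreal (\<beta> * exp (- \<beta> * s)) * (\<integral>\<^sup>+ t\<in>{0..s}. f t \<partial>lborel) \<partial>lborel)"
  proof (rule nn_integral_cong)
    fix s
    have "(\<integral>\<^sup>+ t. h t s \<partial>lborel) = (\<integral>\<^sup>+ t. ennreal (\<beta> * exp (- \<beta> * s)) * (g t * indicator {..s} t) \<partial>lborel)"
      unfolding h_def by (intro nn_integral_cong) (auto simp: indicator_def mult_ac)
    also have "\<dots> = ennreal (\<beta> * exp (- \<beta> * s)) * (\<integral>\<^sup>+ t. g t * indicator {..s} t \<partial>lborel)"
      by (rule nn_integral_cmult) measurable
    also have "(\<integral>\<^sup>+ t. g t * indicator {..s} t \<partial>lborel) = (\<integral>\<^sup>+ t\<in>{0..s}. f t \<partial>lborel)"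
      unfolding g_def by (intro nn_integral_cong) (auto simp: indicator_def)
    finally have inner: "(\<integral>\<^sup>+ t. h t s \<partial>lborel) = ennreal (\<beta> * exp (- \<beta> * s)) * (\<integral>\<^sup>+ t\<in>{0..s}. f t \<partial>lborel)" .
    show "(\<integral>\<^sup>+ t. h t s \<partial>lborel) =
        ennreal (\<beta> * exp (- \<beta> * s)) * (\<integral>\<^sup>+ t\<in>{0..s}. f t \<partial>lborel) * indicator {0..} s"
    proof (cases "0 \<le> s")
      case False
      then have "(\<lambda>t. f t * indicator {0..s} t) = (\<lambda>t. 0)" by (auto simp: indicator_def)
      then show ?thesis using inner by simp
    qed (simp add: inner)
  qed
  finally show ?thesis .
qed

text \<open>
  With zero initial inventory, sales never exceed production cumulatively. This lemma turns that
  family of constraints into the single inequality that the shadow price multiplies.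
\<close>

lemma discounted_le_if_cumulated_le:
  assumes "0 < \<beta>" "f \<in> borel_measurable (restrict_space borel {0..})"
    "g \<in> borel_measurable (restrict_space borel {0..})"
    and le: "\<And>s. 0 \<le> s \<Longrightarrow> (\<integral>\<^sup>+ t\<in>{0..s}. f t \<partial>lborel) \<le> (\<integral>\<^sup>+ t\<in>{0..s}. g t \<partial>lborel)"
  shows "discounted \<beta> f \<le> discounted \<beta> g"
  unfolding discounted_eq_cumulated[OF assms(1,2)] discounted_eq_cumulated[OF assms(1,3)]
  using le by (intro nn_integral_mono) (auto simp: indicator_def intro!: mult_left_mono)

section \<open>Optimality in the convexified problem\<close>

lemma divide_ennreal_less_infinity:
  fixes x :: ennreal
  shows "0 < \<beta> \<Longrightarrow> x < \<infinity> \<Longrightarrow> x / ennreal \<beta> < \<infinity>"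
  by (cases x) (auto simp: divide_ennreal)

text \<open>
  Payoffs are differences that may be \<open>-\<infinity>\<close>. Comparing two of them reduces to an inequality between
  sums of nonnegative quantities.
\<close>

lemma enn2ereal_diff_le:
  assumes "P < \<infinity>" "A < \<infinity>" and le: "P + B \<le> N + A"
  shows "enn2ereal P - enn2ereal N \<le> enn2ereal A - enn2ereal B"
proof (cases "N = \<infinity>")
  case True
  obtain p where "0 \<le> p" "P = ennreal p" using assms(1) by (cases P) auto
  then show ?thesis using True by (simp add: enn2ereal_ennreal)
next
  case False
  then have "B \<noteq> \<infinity>" using le assms(2) by (auto simp: top_unique)
  then obtain p a b n where "P = ennreal p" "A = ennreal a" "B = ennreal b" "N = ennreal n"
      "0 \<le> p" "0 \<le> a" "0 \<le> b" "0 \<le> n"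
    using assms False by (metis ennreal_cases less_irrefl infinity_ennreal_def)
  moreover from this le have "p + b \<le> n + a"
    by (simp add: ennreal_plus[symmetric] del: ennreal_plus)
  ultimately show ?thesis by (simp add: enn2ereal_ennreal)
qed

text \<open>
  A nonnegative integral is monotone for arbitrary functions, so \<open>f\<close> can be replaced by \<open>a - b\<close> in both
  parts of its integral, and additivity is used for the measurable \<open>a\<close> and \<open>b\<close> alone. Here \<open>f\<close> will
  be the payoff rate, the composition of the hulls with arbitrary measurable controls.
\<close>

lemma ereal_integral_le_diff:
  fixes a b :: "'a \<Rightarrow> real"
  assumes [measurable]: "a \<in> borel_measurable M" "b \<in> borel_measurable M"
    and nonneg: "\<And>x. x \<in> space M \<Longrightarrow> 0 \<le> a x" "\<And>x. x \<in> space M \<Longrightarrow> 0 \<le> b x"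
    and fin: "(\<integral>\<^sup>+ x. ennreal (a x) \<partial>M) < \<infinity>"
    and le: "\<And>x. x \<in> space M \<Longrightarrow> f x \<le> ereal (a x - b x)"
  shows "ereal_integral M f \<le> enn2ereal (\<integral>\<^sup>+ x. ennreal (a x) \<partial>M) - enn2ereal (\<integral>\<^sup>+ x. ennreal (b x) \<partial>M)"
proof -
  let ?P = "\<integral>\<^sup>+ x. ennreal (a x - b x) \<partial>M" and ?N = "\<integral>\<^sup>+ x. ennreal (b x - a x) \<partial>M"
  have "(\<integral>\<^sup>+ x. e2ennreal (f x) \<partial>M) \<le> ?P"
    using e2ennreal_mono[OF le] by (intro nn_integral_mono) (simp add: ennreal.abs_eq e2ennreal_ereal)
  moreover have "?N \<le> (\<integral>\<^sup>+ x. e2ennreal (- f x) \<partial>M)"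
  proof (rule nn_integral_mono)
    fix x assume "x \<in> space M"
    then have "- ereal (a x - b x) \<le> - f x" using le by (simp only: ereal_minus_le_minus)
    from e2ennreal_mono[OF this] show "ennreal (b x - a x) \<le> e2ennreal (- f x)"
      by simp
  qed
  ultimately have "ereal_integral M f \<le> enn2ereal ?P - enn2ereal ?N"
    unfolding ereal_integral_def by (intro ereal_minus_mono) (auto simp: less_eq_ennreal.rep_eq)
  also have "\<dots> \<le> enn2ereal (\<integral>\<^sup>+ x. ennreal (a x) \<partial>M) - enn2ereal (\<integral>\<^sup>+ x. ennreal (b x) \<partial>M)"
  proof (rule enn2ereal_diff_le)
    have "?P \<le> (\<integral>\<^sup>+ x. ennreal (a x) \<partial>M)"
      using nonneg by (intro nn_integral_mono ennreal_leI) auto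
    then show "?P < \<infinity>" using fin by (rule le_less_trans)
    have "ennreal (a x - b x) + ennreal (b x) = ennreal (b x - a x) + ennreal (a x)"
      if "x \<in> space M" for x
      using nonneg[OF that]
      by (cases "a x \<le> b x") (auto simp: ennreal_neg ennreal_plus[symmetric] simp del: ennreal_plus)
    then show "?P + (\<integral>\<^sup>+ x. ennreal (b x) \<partial>M) \<le> ?N + (\<integral>\<^sup>+ x. ennreal (a x) \<partial>M)"
      by (subst (1 2) nn_integral_add[symmetric]) (auto intro!: nn_integral_mono)
  qed (rule fin)
  finally show ?thesis .
qed

lemma set_nn_integral_le_if_set_integral_le:
  fixes f g :: "real \<Rightarrow> real"
  assumes "set_integrable M S f" "set_integrable M S g"
    and "\<And>x. x \<in> S \<Longrightarrow> 0 \<le> f x" "\<And>x. x \<in> S \<Longrightarrow> 0 \<le> g x"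
    and "(LINT x:S|M. f x) \<le> (LINT x:S|M. g x)"
  shows "(\<integral>\<^sup>+ x\<in>S. ennreal (f x) \<partial>M) \<le> (\<integral>\<^sup>+ x\<in>S. ennreal (g x) \<partial>M)"
proof -
  have "(\<integral>\<^sup>+ x\<in>S. ennreal (h x) \<partial>M) = ennreal (LINT x:S|M. h x)"
    if "set_integrable M S h" "\<And>x. x \<in> S \<Longrightarrow> 0 \<le> h x" for h :: "real \<Rightarrow> real"
  proof -
    have "(\<integral>\<^sup>+ x\<in>S. ennreal (h x) \<partial>M) = (\<integral>\<^sup>+ x. ennreal (indicator S x *\<^sub>R h x) \<partial>M)"
      by (intro nn_integral_cong) (auto simp: indicator_def)
    also have "\<dots> = ennreal (LINT x:S|M. h x)"
      unfolding set_lebesgue_integral_def using that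
      by (intro nn_integral_eq_integral) (auto simp: set_integrable_def indicator_def)
    finally show ?thesis .
  qed
  then show ?thesis using assms by (simp add: ennreal_leI)
qed

text \<open>
  By the support lines the payoff rate is at most \<open>(r + l * q) - (c + l * \<alpha>)\<close>. The discounted total of
  \<open>l * q\<close> is finite and does not exceed that of \<open>l * \<alpha>\<close>, which may be infinite; what remains is the
  constant rate \<open>r - c\<close>.
\<close>

lemma conv_payoff_le:
  assumes A: "A \<subseteq> {0..}" and Q: "Q \<subseteq> {0..}" "bounded Q" and \<beta>: "0 < \<beta>"
    and nonneg: "0 \<le> l" "0 \<le> r" "0 \<le> c"
    and R: "\<And>q. q \<in> Q \<Longrightarrow> R q \<le> r + l * (q - u)"
    and C: "\<And>a. a \<in> A \<Longrightarrow> c + l * (a - u) \<le> C a"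
    and adm: "(\<alpha>, q) \<in> conv_admissible A Q 0"
  shows "conv_payoff \<beta> A Q R C (\<alpha>, q) \<le> ereal ((r - c) / \<beta>)"
proof -
  let ?M = "restrict_space lborel {0::real..}"
  obtain B where B: "\<And>y. y \<in> Q \<Longrightarrow> y \<le> B"
    using Q(2) by (auto simp: bounded_iff abs_le_iff)
  have \<alpha>_meas: "\<alpha> \<in> borel_measurable (restrict_space borel {0..})"
    and q_meas: "q \<in> borel_measurable (restrict_space borel {0..})"
    and \<alpha>_int: "\<And>t. 0 \<le> t \<Longrightarrow> set_integrable lborel {0..t} \<alpha>"
    and inv: "\<And>t. 0 \<le> t \<Longrightarrow> 0 \<le> (LBINT s:{0..t}. \<alpha> s - q s)"
    using adm by (auto simp: conv_admissible_def)
  have \<alpha>_hull: "\<alpha> t \<in> is_interval hull A" and q_hull: "q t \<in> is_interval hull Q" if "0 \<le> t" for t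
    using adm that by (auto simp: conv_admissible_def)
  have \<alpha>0: "0 \<le> \<alpha> t" if "0 \<le> t" for t
    using \<alpha>_hull[OF that] A by (force simp: mem_interval_hull_iff)
  have q0: "0 \<le> q t" and qB: "q t \<le> B" if "0 \<le> t" for t
    using q_hull[OF that] Q(1) B by (force simp: mem_interval_hull_iff)+
  have M_sets: "borel_measurable ?M = borel_measurable (restrict_space borel {0..})"
    by (intro measurable_cong_sets sets_restrict_space_cong) auto
  have [measurable]: "\<alpha> \<in> borel_measurable ?M" "q \<in> borel_measurable ?M"
    using \<alpha>_meas q_meas by (simp_all only: M_sets)
  have [measurable]: "(\<lambda>t. exp (- \<beta> * t)) \<in> borel_measurable ?M"
    by (rule measurable_restrict_space1) measurable
  have enn_meas: "(\<lambda>t. ennreal (q t)) \<in> borel_measurable (restrict_space borel {0..})"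
      "(\<lambda>t. ennreal (\<alpha> t)) \<in> borel_measurable (restrict_space borel {0..})"
    using \<alpha>_meas q_meas by measurable

  have q_int: "set_integrable lborel {0..t} q" if "0 \<le> t" for t
    unfolding set_integrable_def
  proof (rule Bochner_Integration.integrable_bound)
    show "integrable lborel (\<lambda>x. indicator {0..t} x * B)"
      using that by (intro integrable_mult_left integrable_real_indicator) auto
    have "(\<lambda>x. indicator {0..} x *\<^sub>R q x) \<in> borel_measurable borel"
      using q_meas by (simp add: borel_measurable_restrict_space_iff)
    then have "(\<lambda>x. indicator {0..t} x *\<^sub>R (indicator {0..} x *\<^sub>R q x)) \<in> borel_measurable borel"
      by measurable
    also have "(\<lambda>x. indicator {0..t} x *\<^sub>R (indicator {0..} x *\<^sub>R q x)) = (\<lambda>x. indicator {0..t} x *\<^sub>R q x)"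
      by (auto simp: indicator_def)
    finally show "(\<lambda>x. indicator {0..t} x *\<^sub>R q x) \<in> borel_measurable lborel" by simp
    show "AE x in lborel. norm (indicator {0..t} x *\<^sub>R q x) \<le> norm (indicator {0..t} x * B)"
      using q0 qB by (force simp: indicator_def intro!: AE_I2 intro: order_trans[OF _ abs_ge_self])
  qed
  let ?Iq = "discounted \<beta> (\<lambda>t. ennreal (q t))" and ?I\<alpha> = "discounted \<beta> (\<lambda>t. ennreal (\<alpha> t))"
  have I_le: "?Iq \<le> ?I\<alpha>"
  proof (rule discounted_le_if_cumulated_le[OF \<beta> enn_meas])
    fix s :: real assume s: "0 \<le> s"
    have "(LBINT t:{0..s}. q t) \<le> (LBINT t:{0..s}. \<alpha> t)"
      using inv[OF s] set_integral_diff(2)[OF \<alpha>_int[OF s] q_int[OF s]] by simp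
    then show "(\<integral>\<^sup>+ t\<in>{0..s}. ennreal (q t) \<partial>lborel) \<le> (\<integral>\<^sup>+ t\<in>{0..s}. ennreal (\<alpha> t) \<partial>lborel)"
      using \<alpha>_int[OF s] q_int[OF s] \<alpha>0 q0 by (intro set_nn_integral_le_if_set_integral_le) auto
  qed
  note \<beta>_fin = divide_ennreal_less_infinity[OF \<beta>]
  have "?Iq \<le> discounted \<beta> (\<lambda>t. ennreal B)"
    using qB by (intro discounted_mono ennreal_leI)
  also have "\<dots> < \<infinity>"
    unfolding discounted_const[OF \<beta>] by (rule \<beta>_fin) simp
  finally have Iq_fin: "?Iq < \<infinity>" .

  define rev where "rev t = exp (- \<beta> * t) * (r + l * q t)" for t
  define cost where "cost t = exp (- \<beta> * t) * (c + l * \<alpha> t)" for t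
  have split: "(\<integral>\<^sup>+ t. ennreal (exp (- \<beta> * t) * (k + l * f t)) \<partial>?M) =
      ennreal k / ennreal \<beta> + ennreal l * discounted \<beta> (\<lambda>t. ennreal (f t))"
    if "0 \<le> k" and f0: "\<And>t. 0 \<le> t \<Longrightarrow> 0 \<le> f t" and f_meas: "(\<lambda>t. ennreal (f t)) \<in> borel_measurable (restrict_space borel {0..})"
    for k f
  proof -
    have "(\<integral>\<^sup>+ t. ennreal (exp (- \<beta> * t) * (k + l * f t)) \<partial>?M) =
        discounted \<beta> (\<lambda>t. ennreal k + ennreal l * ennreal (f t))"
    proof (subst nn_integral_restrict_space, simp, unfold discounted_def, rule nn_integral_cong)
      fix t
      have "ennreal (exp (- \<beta> * t) * (k + l * f t)) =
          ennreal (exp (- \<beta> * t)) * (ennreal k + ennreal l * ennreal (f t))" if "0 \<le> t"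
        using \<open>0 \<le> k\<close> nonneg(1) f0[OF that]
        by (simp only: ennreal_mult[symmetric] ennreal_plus[symmetric] mult_nonneg_nonneg
            add_nonneg_nonneg exp_ge_zero)
      then show "ennreal (exp (- \<beta> * t) * (k + l * f t)) * indicator {0..} t =
          ennreal (exp (- \<beta> * t)) * (ennreal k + ennreal l * ennreal (f t)) * indicator {0..} t"
        by (cases "0 \<le> t") auto
    qed
    then show ?thesis by (simp add: discounted_affine[OF \<beta> f_meas])
  qed
  have rev_int: "(\<integral>\<^sup>+ t. ennreal (rev t) \<partial>?M) = ennreal r / ennreal \<beta> + ennreal l * ?Iq"
    unfolding rev_def using nonneg q0 by (intro split enn_meas)
  have cost_int: "(\<integral>\<^sup>+ t. ennreal (cost t) \<partial>?M) = ennreal c / ennreal \<beta> + ennreal l * ?I\<alpha>"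
    unfolding cost_def using nonneg \<alpha>0 by (intro split enn_meas)
  have rev_fin: "(\<integral>\<^sup>+ t. ennreal (rev t) \<partial>?M) < \<infinity>"
    unfolding rev_int using \<beta>_fin[of "ennreal r"] Iq_fin by (simp add: ennreal_mult_less_top)
  have "conv_payoff \<beta> A Q R C (\<alpha>, q) \<le>
      enn2ereal (\<integral>\<^sup>+ t. ennreal (rev t) \<partial>?M) - enn2ereal (\<integral>\<^sup>+ t. ennreal (cost t) \<partial>?M)"
    unfolding conv_payoff_def prod.case
  proof (rule ereal_integral_le_diff)
    show "rev \<in> borel_measurable ?M" "cost \<in> borel_measurable ?M"
      unfolding rev_def cost_def by measurable
    fix t assume "t \<in> space ?M"
    then have t: "0 \<le> t" by simp
    show "0 \<le> rev t" "0 \<le> cost t"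
      using nonneg q0[OF t] \<alpha>0[OF t] by (auto simp: rev_def cost_def)
    have "conc_revenue Q R (q t) \<le> ereal ((r - l * u) + l * q t)"
      by (rule conc_revenue_le_affine) (use R in \<open>force simp: algebra_simps\<close>)
    moreover have "ereal ((c - l * u) + l * \<alpha> t) \<le> conv_cost A C (\<alpha> t)"
      by (rule conv_cost_ge_affine) (use C in \<open>force simp: algebra_simps\<close>)
    ultimately have "conc_revenue Q R (q t) - conv_cost A C (\<alpha> t) \<le>
        ereal ((r - l * u) + l * q t) - ereal ((c - l * u) + l * \<alpha> t)"
      by (rule ereal_minus_mono)
    also have "\<dots> = ereal ((r + l * q t) - (c + l * \<alpha> t))" by simp
    finally have "ereal (exp (- \<beta> * t)) * (conc_revenue Q R (q t) - conv_cost A C (\<alpha> t)) \<le>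
        ereal (exp (- \<beta> * t)) * ereal ((r + l * q t) - (c + l * \<alpha> t))"
      by (rule ereal_mult_left_mono) simp
    then show "ereal (exp (- \<beta> * t)) * (conc_revenue Q R (q t) - conv_cost A C (\<alpha> t)) \<le> ereal (rev t - cost t)"
      by (simp add: rev_def cost_def algebra_simps)
  qed (rule rev_fin)
  also have "\<dots> \<le> enn2ereal (ennreal r / ennreal \<beta>) - enn2ereal (ennreal c / ennreal \<beta>)"
  proof (rule enn2ereal_diff_le[OF rev_fin])
    show "ennreal r / ennreal \<beta> < \<infinity>" by (rule \<beta>_fin) simp
    show "(\<integral>\<^sup>+ t. ennreal (rev t) \<partial>?M) + ennreal c / ennreal \<beta> \<le>
        (\<integral>\<^sup>+ t. ennreal (cost t) \<partial>?M) + ennreal r / ennreal \<beta>"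
      unfolding rev_int cost_int using I_le
      by (simp add: add_ac mult_left_mono)
  qed
  also have "\<dots> = ereal ((r - c) / \<beta>)"
    using nonneg \<beta> by (simp add: divide_ennreal enn2ereal_ennreal diff_divide_distrib)
  finally show ?thesis .
qed

lemma static_conv_admissible:
  assumes "u \<in> is_interval hull A" "u \<in> is_interval hull Q"
  shows "(\<lambda>t. u, \<lambda>t. u) \<in> conv_admissible A Q 0"
  using assms by (auto simp: conv_admissible_def set_integrable_def)

text \<open>
  The rate \<open>r - c\<close> may be negative when \<open>C 0 > 0\<close>, so both parts of the extended integral occur.
\<close>

lemma static_conv_payoff:
  assumes \<beta>: "0 < \<beta>" and "conc_revenue Q R u = ereal r" "conv_cost A C u = ereal c"
  shows "conv_payoff \<beta> A Q R C (\<lambda>t. u, \<lambda>t. u) = ereal ((r - c) / \<beta>)"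
proof -
  have part: "(\<integral>\<^sup>+ t. e2ennreal (ereal (exp (- \<beta> * t) * v)) \<partial>restrict_space lborel {0..}) = ennreal (max 0 v / \<beta>)" for v
  proof -
    have "(\<integral>\<^sup>+ t. e2ennreal (ereal (exp (- \<beta> * t) * v)) \<partial>restrict_space lborel {0..}) = discounted \<beta> (\<lambda>t. ennreal v)"
      unfolding discounted_def
      by (subst nn_integral_restrict_space) (auto simp: ennreal_mult')
    also have "\<dots> = ennreal (max 0 v / \<beta>)"
      using \<beta> by (simp add: discounted_const divide_ennreal[symmetric])
    finally show ?thesis .
  qed
  have neg: "- (ereal (exp (- \<beta> * t)) * (ereal r - ereal c)) = ereal (exp (- \<beta> * t) * (c - r))" for t
    by (simp add: algebra_simps)
  have pos: "ereal (exp (- \<beta> * t)) * (ereal r - ereal c) = ereal (exp (- \<beta> * t) * (r - c))" for t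
    by simp
  have "conv_payoff \<beta> A Q R C (\<lambda>t. u, \<lambda>t. u) =
      enn2ereal (ennreal (max 0 (r - c) / \<beta>)) - enn2ereal (ennreal (max 0 (c - r) / \<beta>))"
    unfolding conv_payoff_def prod.case ereal_integral_def assms(2,3) neg unfolding pos part ..
  also have "\<dots> = ereal ((r - c) / \<beta>)"
    using \<beta> by (auto simp: enn2ereal_ennreal max_def diff_divide_distrib)
  finally show ?thesis .
qed

section \<open>Optimality in the relaxed problem\<close>

lemma
  assumes "relaxed_control S \<mu>" "0 \<le> t"
  shows relaxed_control_prob_space: "prob_space (\<mu> t)"
    and relaxed_control_sets: "sets (\<mu> t) = sets (restrict_space borel S)"
    and relaxed_control_space: "space (\<mu> t) = S"
proof -
  have *: "\<mu> t \<in> space (prob_algebra (restrict_space borel S))"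
    using assms by (simp add: relaxed_control_def)
  then show "prob_space (\<mu> t)" and sets: "sets (\<mu> t) = sets (restrict_space borel S)"
    by (auto simp: space_prob_algebra)
  show "space (\<mu> t) = S"
    using sets_eq_imp_space_eq[OF sets] by (simp add: space_restrict_space)
qed

lemma relaxed_control_measurable:
  assumes "relaxed_control S \<mu>" "0 \<le> t" "continuous_on S f"
  shows "f \<in> borel_measurable (\<mu> t)"
  using borel_measurable_continuous_on_restrict[OF assms(3)] relaxed_control_sets[OF assms(1,2)]
  by (simp cong: measurable_cong_sets)

text \<open>
  Measurability of a relaxed control is given for bounded test functions only; the cost and the
  identity, unbounded on an unbounded \<open>S\<close>, are increasing limits of their truncations.
\<close>

lemma relaxed_control_nn_integral_measurable:
  fixes f :: "real \<Rightarrow> real"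
  assumes \<mu>: "relaxed_control S \<mu>" and f: "continuous_on S f" and nonneg: "\<And>y. y \<in> S \<Longrightarrow> 0 \<le> f y"
  shows "(\<lambda>t. \<integral>\<^sup>+ y. ennreal (f y) \<partial>\<mu> t) \<in> borel_measurable (restrict_space borel {0..})"
proof -
  define g where "g n y = min (f y) (real n)" for n y
  have g_cont: "continuous_on S (g n)" for n
    unfolding g_def using f by (intro continuous_intros)
  have g_bounds: "0 \<le> g n y" "g n y \<le> real n" if "y \<in> S" for n y
    using nonneg[OF that] by (auto simp: g_def)
  have "bounded (g n ` S)" for n
    by (rule bounded_subset[of "{0..real n}"]) (use g_bounds in auto)
  then have [measurable]: "(\<lambda>t. LINT y|\<mu> t. g n y) \<in> borel_measurable (restrict_space borel {0..})" for n
    using \<mu> g_cont[of n] unfolding relaxed_control_def by blast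
  have eq: "(\<integral>\<^sup>+ y. ennreal (f y) \<partial>\<mu> t) = (SUP n. ennreal (LINT y|\<mu> t. g n y))" if t: "0 \<le> t" for t
  proof -
    interpret prob_space "\<mu> t" by (rule relaxed_control_prob_space[OF \<mu> t])
    note sp = relaxed_control_space[OF \<mu> t]
    have g_meas[measurable]: "g n \<in> borel_measurable (\<mu> t)" for n
      by (rule relaxed_control_measurable[OF \<mu> t g_cont])
    have "(SUP n. ennreal (g n y)) = ennreal (f y)" if "y \<in> S" for y
    proof (rule antisym)
      show "(SUP n. ennreal (g n y)) \<le> ennreal (f y)"
        by (intro SUP_least ennreal_leI) (simp add: g_def)
      have "f y \<le> real (nat \<lceil>f y\<rceil>)" by linarith
      then have "ennreal (f y) = ennreal (g (nat \<lceil>f y\<rceil>) y)"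
        by (simp add: g_def)
      also have "\<dots> \<le> (SUP n. ennreal (g n y))" by (rule SUP_upper) simp
      finally show "ennreal (f y) \<le> (SUP n. ennreal (g n y))" .
    qed
    then have "(\<integral>\<^sup>+ y. ennreal (f y) \<partial>\<mu> t) = (\<integral>\<^sup>+ y. (SUP n. ennreal (g n y)) \<partial>\<mu> t)"
      by (intro nn_integral_cong) (simp add: sp)
    also have "\<dots> = (SUP n. \<integral>\<^sup>+ y. ennreal (g n y) \<partial>\<mu> t)"
    proof (rule nn_integral_monotone_convergence_SUP)
      show "incseq (\<lambda>n y. ennreal (g n y))"
        by (auto simp: incseq_def le_fun_def g_def intro!: ennreal_leI)
    qed measurable
    also have "\<dots> = (SUP n. ennreal (LINT y|\<mu> t. g n y))"
      using g_bounds
      by (intro SUP_cong refl nn_integral_eq_integral integrable_const_bound[where B = "real n" for n] AE_I2) (auto simp: sp)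
    finally show ?thesis .
  qed
  have "(\<lambda>t. SUP n. ennreal (LINT y|\<mu> t. g n y)) \<in> borel_measurable (restrict_space borel {0..})"
    by measurable
  then show ?thesis
    by (rule measurable_cong[THEN iffD2, rotated]) (simp add: eq space_restrict_space)
qed

lemma (in prob_space) nn_integral_affine:
  assumes "f \<in> borel_measurable M"
  shows "(\<integral>\<^sup>+ y. k + l * f y \<partial>M) = k + l * (\<integral>\<^sup>+ y. f y \<partial>M)"
  using assms by (simp add: nn_integral_add nn_integral_cmult emeasure_space_1)

text \<open>
  By \<open>fin\<close> the function \<open>F\<close> is infinite at most on a null set, where \<^const>\<open>enn2real\<close> turns it into 0.
  With \<open>F\<close> the mean rate of a relaxed control, this transfers the inventory constraint from Bochner
  integrals to nonnegative ones.
\<close>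

lemma set_integral_enn2real:
  fixes F :: "real \<Rightarrow> ennreal"
  assumes F: "F \<in> borel_measurable (restrict_space borel {0..})"
    and fin: "(\<integral>\<^sup>+ s\<in>{0..t}. F s \<partial>lborel) < \<infinity>"
  shows "(LBINT s:{0..t}. enn2real (F s)) = enn2real (\<integral>\<^sup>+ s\<in>{0..t}. F s \<partial>lborel)"
proof -
  let ?G = "\<lambda>s. F s * indicator {0..t} s"
  have "(\<lambda>s. F s * indicator {0..} s * indicator {0..t} s) \<in> borel_measurable borel"
    using F[unfolded borel_measurable_half_line_iff] by measurable
  also have "(\<lambda>s. F s * indicator {0..} s * indicator {0..t} s) = ?G"
    by (auto simp: indicator_def)
  finally have [measurable]: "?G \<in> borel_measurable lborel" by simp
  have "(LBINT s:{0..t}. enn2real (F s)) = (\<integral>s. enn2real (?G s) \<partial>lborel)"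
    unfolding set_lebesgue_integral_def
    by (intro Bochner_Integration.integral_cong) (auto simp: indicator_def)
  also have "\<dots> = enn2real (\<integral>\<^sup>+ s. ennreal (enn2real (?G s)) \<partial>lborel)"
    by (rule integral_eq_nn_integral) auto
  also have "(\<integral>\<^sup>+ s. ennreal (enn2real (?G s)) \<partial>lborel) = (\<integral>\<^sup>+ s. ?G s \<partial>lborel)"
  proof (rule nn_integral_cong_AE)
    have "AE s in lborel. ?G s \<noteq> \<infinity>"
      using fin by (intro nn_integral_PInf_AE) auto
    then show "AE s in lborel. ennreal (enn2real (?G s)) = ?G s"
      by eventually_elim (simp add: less_top)
  qed
  finally show ?thesis .
qed

text \<open>
  The support lines are averaged over the two measures at each time, which leaves inequalities
  between mean payoffs and mean rates; then the argument is that of the convexified problem. The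
  terms are arranged so that both sides are nonnegative, with \<open>l * u\<close> moved across, since the mean cost
  and the discounted production can be infinite.
\<close>

lemma relaxed_payoff_le:
  assumes A: "A \<subseteq> {0..}" and Q: "Q \<subseteq> {0..}" "bounded Q" and \<beta>: "0 < \<beta>" and u: "0 \<le> u"
    and nonneg: "0 \<le> l" "0 \<le> r" "0 \<le> c"
    and R_cont: "continuous_on Q R" and R0: "\<And>q. q \<in> Q \<Longrightarrow> 0 \<le> R q"
    and C_cont: "continuous_on A C" and C0: "\<And>a. a \<in> A \<Longrightarrow> 0 \<le> C a"
    and R: "\<And>q. q \<in> Q \<Longrightarrow> R q \<le> r + l * (q - u)"
    and C: "\<And>a. a \<in> A \<Longrightarrow> c + l * (a - u) \<le> C a"
    and adm: "(\<alpha>, q) \<in> relaxed_admissible A Q 0"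
  shows "relaxed_payoff \<beta> R C (\<alpha>, q) \<le> ereal ((r - c) / \<beta>)"
proof -
  obtain B where B: "\<And>y. y \<in> Q \<Longrightarrow> y \<le> B"
    using Q(2) by (auto simp: bounded_iff abs_le_iff)
  have \<alpha>: "relaxed_control A \<alpha>" and q: "relaxed_control Q q"
    and \<alpha>_int: "\<And>t. 0 \<le> t \<Longrightarrow> (\<integral>\<^sup>+ s\<in>{0..t}. (\<integral>\<^sup>+ y. ennreal y \<partial>\<alpha> s) \<partial>lborel) < \<infinity>"
    and inv: "\<And>t. 0 \<le> t \<Longrightarrow> (LBINT s:{0..t}. (LINT y|q s. y)) \<le> (LBINT s:{0..t}. (LINT y|\<alpha> s. y))"
    using adm by (auto simp: relaxed_admissible_def)
  define m\<alpha> where "m\<alpha> t = (\<integral>\<^sup>+ y. ennreal y \<partial>\<alpha> t)" for t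
  define mq where "mq t = (\<integral>\<^sup>+ y. ennreal y \<partial>q t)" for t
  define IR where "IR t = (\<integral>\<^sup>+ y. ennreal (R y) \<partial>q t)" for t
  define IC where "IC t = (\<integral>\<^sup>+ y. ennreal (C y) \<partial>\<alpha> t)" for t
  have meas: "m\<alpha> \<in> borel_measurable (restrict_space borel {0..})"
      "mq \<in> borel_measurable (restrict_space borel {0..})"
      "IR \<in> borel_measurable (restrict_space borel {0..})"
      "IC \<in> borel_measurable (restrict_space borel {0..})"
    unfolding m\<alpha>_def[abs_def] mq_def[abs_def] IR_def[abs_def] IC_def[abs_def]
    using relaxed_control_nn_integral_measurable[OF \<alpha> continuous_on_id]
      relaxed_control_nn_integral_measurable[OF q continuous_on_id]
      relaxed_control_nn_integral_measurable[OF q R_cont R0]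
      relaxed_control_nn_integral_measurable[OF \<alpha> C_cont C0] A Q(1)
    by auto
  have mean_\<alpha>: "(LINT y|\<alpha> t. y) = enn2real (m\<alpha> t)" if "0 \<le> t" for t
    unfolding m\<alpha>_def
    using relaxed_control_measurable[OF \<alpha> that continuous_on_id] relaxed_control_space[OF \<alpha> that] A
    by (intro integral_eq_nn_integral AE_I2) auto
  have mean_q: "(LINT y|q t. y) = enn2real (mq t)" if "0 \<le> t" for t
    unfolding mq_def
    using relaxed_control_measurable[OF q that continuous_on_id] relaxed_control_space[OF q that] Q
    by (intro integral_eq_nn_integral AE_I2) auto
  have mq_le: "mq t \<le> ennreal B" if "0 \<le> t" for t
  proof -
    interpret prob_space "q t" by (rule relaxed_control_prob_space[OF q that])
    have "mq t \<le> (\<integral>\<^sup>+ y. ennreal B \<partial>q t)"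
      unfolding mq_def using B relaxed_control_space[OF q that] by (intro nn_integral_mono ennreal_leI) auto
    then show ?thesis by (simp add: emeasure_space_1)
  qed

  have I_le: "discounted \<beta> mq \<le> discounted \<beta> m\<alpha>"
  proof (rule discounted_le_if_cumulated_le[OF \<beta> meas(2,1)])
    fix t :: real assume t: "0 \<le> t"
    have m\<alpha>_fin: "(\<integral>\<^sup>+ s\<in>{0..t}. m\<alpha> s \<partial>lborel) < \<infinity>"
      using \<alpha>_int[OF t] by (simp add: m\<alpha>_def)
    have "(\<integral>\<^sup>+ s\<in>{0..t}. mq s \<partial>lborel) \<le> (\<integral>\<^sup>+ s\<in>{0..t}. ennreal B \<partial>lborel)"
      using mq_le by (intro nn_integral_mono) (auto simp: indicator_def)
    also have "\<dots> < \<infinity>"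
      using t by (simp add: nn_integral_cmult ennreal_mult_less_top)
    finally have mq_fin: "(\<integral>\<^sup>+ s\<in>{0..t}. mq s \<partial>lborel) < \<infinity>" .
    have "(LBINT s:{0..t}. (LINT y|q s. y)) = (LBINT s:{0..t}. enn2real (mq s))"
      by (rule set_lebesgue_integral_cong) (auto simp: mean_q)
    moreover have "(LBINT s:{0..t}. (LINT y|\<alpha> s. y)) = (LBINT s:{0..t}. enn2real (m\<alpha> s))"
      by (rule set_lebesgue_integral_cong) (auto simp: mean_\<alpha>)
    ultimately have "enn2real (\<integral>\<^sup>+ s\<in>{0..t}. mq s \<partial>lborel) \<le> enn2real (\<integral>\<^sup>+ s\<in>{0..t}. m\<alpha> s \<partial>lborel)"
      using inv[OF t] set_integral_enn2real[OF meas(1) m\<alpha>_fin] set_integral_enn2real[OF meas(2) mq_fin]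
      by simp
    then have "ennreal (enn2real (\<integral>\<^sup>+ s\<in>{0..t}. mq s \<partial>lborel)) \<le> ennreal (enn2real (\<integral>\<^sup>+ s\<in>{0..t}. m\<alpha> s \<partial>lborel))"
      by (rule ennreal_leI)
    then show "(\<integral>\<^sup>+ s\<in>{0..t}. mq s \<partial>lborel) \<le> (\<integral>\<^sup>+ s\<in>{0..t}. m\<alpha> s \<partial>lborel)"
      using m\<alpha>_fin mq_fin by (simp only: ennreal_enn2real infinity_ennreal_def)
  qed

  have IR_le: "ennreal (l * u) + IR t \<le> ennreal r + ennreal l * mq t" if t: "0 \<le> t" for t
  proof -
    interpret prob_space "q t" by (rule relaxed_control_prob_space[OF q t])
    note [measurable] = relaxed_control_measurable[OF q t continuous_on_id] relaxed_control_measurable[OF q t R_cont]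
    have "ennreal (l * u) + 1 * IR t = (\<integral>\<^sup>+ y. ennreal (l * u) + 1 * ennreal (R y) \<partial>q t)"
      unfolding IR_def by (rule nn_integral_affine[symmetric]) measurable
    also have "\<dots> \<le> (\<integral>\<^sup>+ y. ennreal r + ennreal l * ennreal y \<partial>q t)"
    proof (rule nn_integral_mono)
      fix y assume "y \<in> space (q t)"
      then have y: "y \<in> Q" by (simp add: relaxed_control_space[OF q t])
      then have "l * u + R y \<le> r + l * y" "0 \<le> R y" "0 \<le> y"
        using R[OF y] R0[OF y] Q by (auto simp: algebra_simps)
      then show "ennreal (l * u) + 1 * ennreal (R y) \<le> ennreal r + ennreal l * ennreal y"
        using nonneg u by (simp add: ennreal_mult[symmetric] ennreal_plus[symmetric] del: ennreal_plus)
    qed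
    also have "\<dots> = ennreal r + ennreal l * mq t"
      unfolding mq_def by (rule nn_integral_affine) measurable
    finally show ?thesis by simp
  qed
  have IC_ge: "ennreal c + ennreal l * m\<alpha> t \<le> ennreal (l * u) + IC t" if t: "0 \<le> t" for t
  proof -
    interpret prob_space "\<alpha> t" by (rule relaxed_control_prob_space[OF \<alpha> t])
    note [measurable] = relaxed_control_measurable[OF \<alpha> t continuous_on_id] relaxed_control_measurable[OF \<alpha> t C_cont]
    have "ennreal c + ennreal l * m\<alpha> t = (\<integral>\<^sup>+ y. ennreal c + ennreal l * ennreal y \<partial>\<alpha> t)"
      unfolding m\<alpha>_def by (rule nn_integral_affine[symmetric]) measurable
    also have "\<dots> \<le> (\<integral>\<^sup>+ y. ennreal (l * u) + 1 * ennreal (C y) \<partial>\<alpha> t)"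
    proof (rule nn_integral_mono)
      fix y assume "y \<in> space (\<alpha> t)"
      then have y: "y \<in> A" by (simp add: relaxed_control_space[OF \<alpha> t])
      then have "c + l * y \<le> l * u + C y" "0 \<le> C y" "0 \<le> y"
        using C[OF y] C0[OF y] A by (auto simp: algebra_simps)
      then show "ennreal c + ennreal l * ennreal y \<le> ennreal (l * u) + 1 * ennreal (C y)"
        using nonneg u by (simp add: ennreal_mult[symmetric] ennreal_plus[symmetric] del: ennreal_plus)
    qed
    also have "\<dots> = ennreal (l * u) + 1 * IC t"
      unfolding IC_def by (rule nn_integral_affine) measurable
    finally show ?thesis by simp
  qed
  note \<beta>_fin = divide_ennreal_less_infinity[OF \<beta>]
  have "discounted \<beta> mq \<le> discounted \<beta> (\<lambda>t. ennreal B)"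
    using mq_le by (rule discounted_mono)
  also have "\<dots> < \<infinity>"
    unfolding discounted_const[OF \<beta>] by (rule \<beta>_fin) simp
  finally have Iq_fin: "discounted \<beta> mq < \<infinity>" .

  let ?r = "ennreal r / ennreal \<beta>" and ?c = "ennreal c / ennreal \<beta>" and ?k = "ennreal (l * u) / ennreal \<beta>"
  have DR: "?k + discounted \<beta> IR \<le> ?r + ennreal l * discounted \<beta> mq"
    using discounted_mono[of "\<lambda>t. ennreal (l * u) + 1 * IR t" "\<lambda>t. ennreal r + ennreal l * mq t" \<beta>] IR_le
    unfolding discounted_affine[OF \<beta> meas(3)] discounted_affine[OF \<beta> meas(2)] by simp
  have DC: "?c + ennreal l * discounted \<beta> m\<alpha> \<le> ?k + discounted \<beta> IC"
    using discounted_mono[of "\<lambda>t. ennreal c + ennreal l * m\<alpha> t" "\<lambda>t. ennreal (l * u) + 1 * IC t" \<beta>] IC_ge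
    unfolding discounted_affine[OF \<beta> meas(4)] discounted_affine[OF \<beta> meas(1)] by simp
  have r_fin: "?r < \<infinity>" and k_fin: "?k < \<infinity>" by (rule \<beta>_fin; simp)+
  have DR_fin: "discounted \<beta> IR < \<infinity>"
  proof -
    have "discounted \<beta> IR \<le> ?r + ennreal l * discounted \<beta> mq"
      using DR by (rule order_trans[rotated]) simp
    also have "\<dots> < \<infinity>"
      using r_fin Iq_fin by (simp add: ennreal_mult_less_top)
    finally show ?thesis .
  qed
  have main: "discounted \<beta> IR + ?c \<le> discounted \<beta> IC + ?r"
  proof (cases "discounted \<beta> IC = \<infinity>")
    case False
    \<comment> \<open>The common term \<open>?z\<close> of both sides cancels: it is finite because the total cost bounds the value of production.\<close>
    let ?z = "?k + ennreal l * discounted \<beta> m\<alpha>"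
    have "ennreal l * discounted \<beta> m\<alpha> \<le> ?k + discounted \<beta> IC"
      using DC by (rule order_trans[rotated]) simp
    also have "\<dots> < \<infinity>"
      using False k_fin by (simp add: less_top)
    finally have z_fin: "?z \<noteq> \<infinity>"
      using k_fin by (auto simp: less_top)
    have "?z + (discounted \<beta> IR + ?c) = (?k + discounted \<beta> IR) + (?c + ennreal l * discounted \<beta> m\<alpha>)"
      by (simp add: ac_simps)
    also have "\<dots> \<le> (?r + ennreal l * discounted \<beta> mq) + (?k + discounted \<beta> IC)"
      by (rule add_mono[OF DR DC])
    also have "\<dots> \<le> (?r + ennreal l * discounted \<beta> m\<alpha>) + (?k + discounted \<beta> IC)"
      using I_le by (intro add_mono mult_left_mono order_refl) auto
    also have "\<dots> = ?z + (discounted \<beta> IC + ?r)"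
      by (simp add: ac_simps)
    finally show ?thesis
      using z_fin by (simp only: ennreal_add_left_cancel_le) simp
  qed simp
  have "relaxed_payoff \<beta> R C (\<alpha>, q) = enn2ereal (discounted \<beta> IR) - enn2ereal (discounted \<beta> IC)"
    unfolding relaxed_payoff_def prod.case discounted_def IR_def IC_def ..
  also have "\<dots> \<le> enn2ereal ?r - enn2ereal ?c"
    by (rule enn2ereal_diff_le[OF DR_fin r_fin main])
  also have "\<dots> = ereal ((r - c) / \<beta>)"
    using nonneg \<beta> by (simp add: divide_ennreal enn2ereal_ennreal diff_divide_distrib)
  finally show ?thesis .
qed

lemma relaxed_control_two_point:
  assumes "0 \<le> p" "p \<le> 1" "a \<in> S" "b \<in> S"
  shows "relaxed_control S (\<lambda>t. two_point_measure (restrict_space borel S) p a b)"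
  using assms two_point_measure_in_prob_algebra[of p a "restrict_space borel S" b]
  by (simp add: relaxed_control_def space_restrict_space)

lemma static_relaxed_admissible:
  assumes A: "A \<subseteq> {0..}" "a1 \<in> A" "a2 \<in> A" and \<nu>: "0 \<le> \<nu>" "\<nu> \<le> 1" "u = \<nu> * a1 + (1 - \<nu>) * a2"
    and Q: "q1 \<in> Q" "q2 \<in> Q" and \<gamma>: "0 \<le> \<gamma>" "\<gamma> \<le> 1" "u = \<gamma> * q1 + (1 - \<gamma>) * q2"
  shows "(\<lambda>t. two_point_measure (restrict_space borel A) \<nu> a1 a2,
      \<lambda>t. two_point_measure (restrict_space borel Q) \<gamma> q1 q2) \<in> relaxed_admissible A Q 0"
proof -
  have id: "(\<lambda>y. y) \<in> borel_measurable (restrict_space borel S)" for S :: "real set"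
    by (rule measurable_restrict_space1) simp
  have "(\<integral>\<^sup>+ y. ennreal y \<partial>two_point_measure (restrict_space borel A) \<nu> a1 a2) = ennreal u"
    unfolding \<nu>(3) using A \<nu>(1,2) id
    by (intro nn_integral_two_point_measure) (auto simp: space_restrict_space)
  moreover have "(LINT y|two_point_measure (restrict_space borel A) \<nu> a1 a2. y) = u"
    unfolding \<nu>(3) using A \<nu>(1,2) id
    by (intro integral_two_point_measure) (auto simp: space_restrict_space)
  moreover have "(LINT y|two_point_measure (restrict_space borel Q) \<gamma> q1 q2. y) = u"
    unfolding \<gamma>(3) using Q \<gamma>(1,2) id
    by (intro integral_two_point_measure) (auto simp: space_restrict_space)
  ultimately show ?thesis
    unfolding relaxed_admissible_def
    using relaxed_control_two_point[OF \<nu>(1,2) A(2,3)] relaxed_control_two_point[OF \<gamma>(1,2) Q]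
    by (simp add: nn_integral_cmult ennreal_mult_less_top)
qed

lemma static_relaxed_payoff:
  assumes \<beta>: "0 < \<beta>"
    and A: "a1 \<in> A" "a2 \<in> A" and C: "continuous_on A C" "\<And>a. a \<in> A \<Longrightarrow> 0 \<le> C a" and \<nu>: "0 \<le> \<nu>" "\<nu> \<le> 1"
    and Q: "q1 \<in> Q" "q2 \<in> Q" and R: "continuous_on Q R" "\<And>q. q \<in> Q \<Longrightarrow> 0 \<le> R q" and \<gamma>: "0 \<le> \<gamma>" "\<gamma> \<le> 1"
  shows "relaxed_payoff \<beta> R C (\<lambda>t. two_point_measure (restrict_space borel A) \<nu> a1 a2,
      \<lambda>t. two_point_measure (restrict_space borel Q) \<gamma> q1 q2) =
    ereal (((\<gamma> * R q1 + (1 - \<gamma>) * R q2) - (\<nu> * C a1 + (1 - \<nu>) * C a2)) / \<beta>)"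
proof -
  have payoff: "relaxed_payoff \<beta> R C (\<alpha>, q) =
      enn2ereal (discounted \<beta> (\<lambda>t. \<integral>\<^sup>+ y. ennreal (R y) \<partial>q t)) -
      enn2ereal (discounted \<beta> (\<lambda>t. \<integral>\<^sup>+ y. ennreal (C y) \<partial>\<alpha> t))" for \<alpha> q
    unfolding relaxed_payoff_def prod.case discounted_def ..
  have "(\<integral>\<^sup>+ y. ennreal (R y) \<partial>two_point_measure (restrict_space borel Q) \<gamma> q1 q2) =
      ennreal (\<gamma> * R q1 + (1 - \<gamma>) * R q2)"
    using Q R \<gamma> borel_measurable_continuous_on_restrict[OF R(1)]
    by (intro nn_integral_two_point_measure) (auto simp: space_restrict_space)
  moreover have "(\<integral>\<^sup>+ y. ennreal (C y) \<partial>two_point_measure (restrict_space borel A) \<nu> a1 a2) =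
      ennreal (\<nu> * C a1 + (1 - \<nu>) * C a2)"
    using A C \<nu> borel_measurable_continuous_on_restrict[OF C(1)]
    by (intro nn_integral_two_point_measure) (auto simp: space_restrict_space)
  moreover have "0 \<le> \<gamma> * R q1 + (1 - \<gamma>) * R q2" "0 \<le> \<nu> * C a1 + (1 - \<nu>) * C a2"
    using Q R \<gamma> A C \<nu> by auto
  ultimately show ?thesis
    using \<beta> by (simp add: payoff discounted_const divide_ennreal enn2ereal_ennreal diff_divide_distrib)
qed

section \<open>Static strategies are optimal\<close>

theorem theorem5:
  fixes A Q :: "real set" and R C :: "real \<Rightarrow> real" and \<beta> u :: real
  assumes "closed A" and "A \<subseteq> {0..}" and "0 \<in> A" and "A - {0} \<noteq> {}"
    and "compact Q" and "Q \<subseteq> {0..}" and "0 \<in> Q" and "Q - {0} \<noteq> {}"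
    and "continuous_on Q R" and "\<And>y. y \<in> Q \<Longrightarrow> R y \<ge> 0" and "R 0 = 0"
    and "continuous_on A C" and "\<And>a. a \<in> A \<Longrightarrow> C a \<ge> 0" and "mono_on A C"
    and "\<not> bounded A \<Longrightarrow> filterlim (\<lambda>a. C a / a) at_top (inf at_top (principal A))"
    and "\<beta> > 0"
    and "is_arg_max (\<lambda>w. conc_revenue Q R w - conv_cost A C w)
           (\<lambda>w. w \<in> is_interval hull Q \<inter> is_interval hull A) u"
  shows
    "((\<lambda>t. u, \<lambda>t. u) \<in> conv_admissible A Q 0 \<and>
      conv_payoff \<beta> A Q R C (\<lambda>t. u, \<lambda>t. u) = conv_value \<beta> A Q R C 0) \<and>
     (let represents = (\<lambda>q1 q2 a1 a2 \<gamma> \<nu>.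
            q1 \<in> Q \<and> q2 \<in> Q \<and> a1 \<in> A \<and> a2 \<in> A \<and> \<gamma> \<in> {0<..<1} \<and> \<nu> \<in> {0<..<1} \<and>
            u = \<gamma> * q1 + (1 - \<gamma>) * q2 \<and> u = \<nu> * a1 + (1 - \<nu>) * a2 \<and>
            conc_revenue Q R u = ereal (\<gamma> * R q1 + (1 - \<gamma>) * R q2) \<and>
            conv_cost A C u = ereal (\<nu> * C a1 + (1 - \<nu>) * C a2))
      in (\<exists>q1 q2 a1 a2 \<gamma> \<nu>. represents q1 q2 a1 a2 \<gamma> \<nu>) \<and>
         (\<forall>q1 q2 a1 a2 \<gamma> \<nu>. represents q1 q2 a1 a2 \<gamma> \<nu> \<longrightarrow>
            (let qbar = (\<lambda>t. two_point_measure (restrict_space borel Q) \<gamma> q1 q2);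
                 abar = (\<lambda>t. two_point_measure (restrict_space borel A) \<nu> a1 a2)
             in (abar, qbar) \<in> relaxed_admissible A Q 0 \<and>
                relaxed_payoff \<beta> R C (abar, qbar) = relaxed_value \<beta> A Q R C 0)))"
proof -
  have u: "u \<in> is_interval hull Q" "u \<in> is_interval hull A"
    and max: "\<And>w. w \<in> is_interval hull Q \<inter> is_interval hull A \<Longrightarrow>
      conc_revenue Q R w - conv_cost A C w \<le> conc_revenue Q R u - conv_cost A C u"
    using assms(17) by (auto simp: is_arg_max_def not_less)
  obtain \<gamma> q1 q2 where q_rep: "\<gamma> \<in> {0<..<1}" "q1 \<in> Q" "q2 \<in> Q" "u = \<gamma> * q1 + (1 - \<gamma>) * q2"
      "conc_revenue Q R u = ereal (\<gamma> * R q1 + (1 - \<gamma>) * R q2)"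
    by (rule conc_revenue_attained[OF assms(5,9) u(1)])
  obtain \<nu> a1 a2 where a_rep: "\<nu> \<in> {0<..<1}" "a1 \<in> A" "a2 \<in> A" "u = \<nu> * a1 + (1 - \<nu>) * a2"
      "conv_cost A C u = ereal (\<nu> * C a1 + (1 - \<nu>) * C a2)"
    by (rule conv_cost_attained[OF assms(1,2,12,13,14,15) u(2)])
  define r where "r = \<gamma> * R q1 + (1 - \<gamma>) * R q2"
  define c where "c = \<nu> * C a1 + (1 - \<nu>) * C a2"
  have r: "conc_revenue Q R u = ereal r" and c: "conv_cost A C u = ereal c"
    using q_rep(5) a_rep(5) by (simp_all add: r_def c_def)
  have nonneg: "0 \<le> u" "0 \<le> r" "0 \<le> c"
    using q_rep a_rep assms(6,10,13) by (auto simp: r_def c_def intro!: add_nonneg_nonneg mult_nonneg_nonneg)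
  have "conc_revenue Q R w - conv_cost A C w \<le> ereal (r - c)"
    if "w \<in> is_interval hull Q \<inter> is_interval hull A" for w
    using max[OF that] by (simp add: r c)
  from shadow_price[OF assms(2,3,4,14,6,7) r c this]
  obtain l where l: "0 \<le> l" "\<And>q. q \<in> Q \<Longrightarrow> R q \<le> r + l * (q - u)" "\<And>a. a \<in> A \<Longrightarrow> c + l * (a - u) \<le> C a"
    by blast
  have Q_bdd: "bounded Q" using assms(5) by (rule compact_imp_bounded)

  have conv_adm: "(\<lambda>t. u, \<lambda>t. u) \<in> conv_admissible A Q 0"
    by (rule static_conv_admissible[OF u(2,1)])
  have conv_opt: "conv_payoff \<beta> A Q R C (\<lambda>t. u, \<lambda>t. u) = conv_value \<beta> A Q R C 0"
    unfolding conv_value_def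
  proof (rule antisym)
    show "conv_payoff \<beta> A Q R C (\<lambda>t. u, \<lambda>t. u) \<le> (SUP s\<in>conv_admissible A Q 0. conv_payoff \<beta> A Q R C s)"
      by (rule SUP_upper[OF conv_adm])
    show "(SUP s\<in>conv_admissible A Q 0. conv_payoff \<beta> A Q R C s) \<le> conv_payoff \<beta> A Q R C (\<lambda>t. u, \<lambda>t. u)"
      unfolding static_conv_payoff[OF assms(16) r c]
      using conv_payoff_le[OF assms(2,6) Q_bdd assms(16) l(1) nonneg(2,3) l(2,3)]
      by (intro SUP_least) auto
  qed

  have relaxed_adm: "(\<lambda>t. two_point_measure (restrict_space borel A) \<nu>' b1 b2,
        \<lambda>t. two_point_measure (restrict_space borel Q) \<gamma>' p1 p2) \<in> relaxed_admissible A Q 0"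
      (is "?s \<in> _")
    and relaxed_opt: "relaxed_payoff \<beta> R C (\<lambda>t. two_point_measure (restrict_space borel A) \<nu>' b1 b2,
        \<lambda>t. two_point_measure (restrict_space borel Q) \<gamma>' p1 p2) = relaxed_value \<beta> A Q R C 0"
    if rep: "p1 \<in> Q" "p2 \<in> Q" "b1 \<in> A" "b2 \<in> A" "\<gamma>' \<in> {0<..<1}" "\<nu>' \<in> {0<..<1}"
      "u = \<gamma>' * p1 + (1 - \<gamma>') * p2" "u = \<nu>' * b1 + (1 - \<nu>') * b2"
      "conc_revenue Q R u = ereal (\<gamma>' * R p1 + (1 - \<gamma>') * R p2)"
      "conv_cost A C u = ereal (\<nu>' * C b1 + (1 - \<nu>') * C b2)" for p1 p2 b1 b2 \<gamma>' \<nu>'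
  proof -
    have w: "0 \<le> \<gamma>'" "\<gamma>' \<le> 1" "0 \<le> \<nu>'" "\<nu>' \<le> 1" using rep by auto
    show adm: "?s \<in> relaxed_admissible A Q 0"
      by (rule static_relaxed_admissible[OF assms(2) rep(3,4) w(3,4) rep(8) rep(1,2) w(1,2) rep(7)])
    have "r = \<gamma>' * R p1 + (1 - \<gamma>') * R p2" "c = \<nu>' * C b1 + (1 - \<nu>') * C b2"
      using r c rep(9,10) by simp_all
    then have val: "relaxed_payoff \<beta> R C ?s = ereal ((r - c) / \<beta>)"
      using static_relaxed_payoff[OF assms(16) rep(3,4) assms(12,13) w(3,4) rep(1,2) assms(9,10) w(1,2)] by simp
    show "relaxed_payoff \<beta> R C ?s = relaxed_value \<beta> A Q R C 0"
      unfolding relaxed_value_def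
    proof (rule antisym)
      show "relaxed_payoff \<beta> R C ?s \<le> (SUP s\<in>relaxed_admissible A Q 0. relaxed_payoff \<beta> R C s)"
        by (rule SUP_upper[OF adm])
      show "(SUP s\<in>relaxed_admissible A Q 0. relaxed_payoff \<beta> R C s) \<le> relaxed_payoff \<beta> R C ?s"
        unfolding val
        using relaxed_payoff_le[OF assms(2,6) Q_bdd assms(16) nonneg(1) l(1) nonneg(2,3)
            assms(9,10,12,13) l(2,3)]
        by (intro SUP_least) auto
    qed
  qed
  have ex: "\<exists>q1 q2 a1 a2 \<gamma> \<nu>. q1 \<in> Q \<and> q2 \<in> Q \<and> a1 \<in> A \<and> a2 \<in> A \<and> \<gamma> \<in> {0<..<1} \<and> \<nu> \<in> {0<..<1} \<and>
            u = \<gamma> * q1 + (1 - \<gamma>) * q2 \<and> u = \<nu> * a1 + (1 - \<nu>) * a2 \<and>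
            conc_revenue Q R u = ereal (\<gamma> * R q1 + (1 - \<gamma>) * R q2) \<and>
            conv_cost A C u = ereal (\<nu> * C a1 + (1 - \<nu>) * C a2)"
    using q_rep a_rep by blast
  show ?thesis
    unfolding Let_def
    by (intro conjI allI impI conv_adm conv_opt ex; elim conjE; rule relaxed_adm relaxed_opt)
qed

end
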